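(* For every integer $k\ge2$ the polynomials $p_{2k}(\nu)\in\mathbb C[\nu]$ satisfy the Harer-Zagier recurrence relation $$(k+1)\,p_{2k}(\nu)=(4k-2)\,\nu\,p_{2k-2}(\nu)+(k-1)(2k-1)(2k-3)\,p_{2k-4}(\nu),$$ where $p_i(\nu)$ is the unique polynomial in $\nu$ representing the cohomology class of the cocycle $(x^i)$ in the complex $\mathrm P^{\mathrm{nc}}_{\hbar=1}[\Sigma\mathcal A]$ (in particular $p_0(\nu)=\nu$).
   Context: $\mathcal A$ is the two-dimensional complex with basis $a$ (degree 1), $b$ (degree 2), symmetric pairing $\langle a,b\rangle=1$, differential $da=b$, viewed as a cyclic $A_\infty$-algebra over $\mathbb C$ with zero multiplication and higher operations. $(\Sigma\mathcal A)^*$ has basis $x$ of degree $0$ and $\xi$ of degree $-1$, with inverse pairing $\langle x,\xi\rangle^{-1}=\langle\xi,x\rangle^{-1}=1$ (other pairings zero), and dual differential $d\xi=-x$, $dx=0$. $\mathrm H[\Sigma\mathcal A]=\bigoplus_{k\ge0}[((\Sigma\mathcal A)^* )^{\otimes k}]_{\mathbb Z/k}$ is the space of cyclic words in $x,\xi$ (coinvariants with Koszul signs); the empty word is denoted $\nu$ and $x^i$ denotes the cyclic word $x\cdots x$ of length $i$ (so $x^0=\nu$). It has bracket $$\{(a_1\cdots a_m),(b_1\cdots b_n)\}=\sum_{i,j}\pm\langle a_i,b_j\rangle^{-1}(a_{i+1}\cdots a_ma_1\cdots a_{i-1}b_{j+1}\cdots b_nb_1\cdots b_{j-1})$$ and cobracket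 $$\nabla(a_1\cdots a_n)=\sum_{i<j}\pm\langle a_i,a_j\rangle^{-1}(a_{i+1}\cdots a_{j-1})(a_{j+1}\cdots a_na_1\cdots a_{i-1}),$$ with Koszul signs. $\mathrm P^{\mathrm{nc}}_{\hbar=1}[\Sigma\mathcal A]$ is the graded symmetric algebra $S(\mathrm H[\Sigma\mathcal A])=\mathbb C[\nu]\otimes S(\mathrm H_+[\Sigma\mathcal A])$ ($\mathrm H_+$ spanned by nonempty words) with differential $d+\delta+\nabla$, where $d$ and $\nabla$ are extended as derivations and $\delta(w_1\cdots w_n)=\sum_{i<j}\pm\{w_i,w_j\}w_1\cdots\widehat{w_i}\cdots\widehat{w_j}\cdots w_n$ for $w_i\in\mathrm H[\Sigma\mathcal A]$. The inclusion $\mathbb C[\nu]\to\mathrm P^{\mathrm{nc}}_{\hbar=1}[\Sigma\mathcal A]$ ($\mathbb C[\nu]$ with zero differential) is a quasi-isomorphism, so every cohomology class is represented by a unique polynomial in $\nu$; every $(x^i)$ is a cocycle. *)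

theory Defs
  imports Complex_Main "HOL-Library.Poly_Mapping" "HOL-Computational_Algebra.Polynomial"
begin

section \<open>Finitely supported combinations over the complex numbers\<close>

definition scale :: "complex \<Rightarrow> ('a \<Rightarrow>\<^sub>0 complex) \<Rightarrow> ('a \<Rightarrow>\<^sub>0 complex)" where
  "scale c z = Poly_Mapping.map ((*) c) z"

lemma lookup_scale [simp]: "Poly_Mapping.lookup (scale c z) k = c * Poly_Mapping.lookup z k"
  by (simp add: scale_def Poly_Mapping.map.rep_eq when_def)

interpretation free: vector_space "scale :: complex \<Rightarrow> ('a \<Rightarrow>\<^sub>0 complex) \<Rightarrow> _"
  by unfold_locales (auto intro!: poly_mapping_eqI simp: lookup_add algebra_simps)

definition lin_ext ::
  "('a \<Rightarrow> ('b \<Rightarrow>\<^sub>0 complex)) \<Rightarrow> ('a \<Rightarrow>\<^sub>0 complex) \<Rightarrow> ('b \<Rightarrow>\<^sub>0 complex)" where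
  "lin_ext f z = (\<Sum>k\<in>Poly_Mapping.keys z. scale (Poly_Mapping.lookup z k) (f k))"

definition basis :: "'a \<Rightarrow> ('a \<Rightarrow>\<^sub>0 complex)" where
  "basis k = Poly_Mapping.single k 1"


section \<open>Letters and words\<close>

datatype letter = X | Xi

type_synonym word = "letter list"

fun deg :: "letter \<Rightarrow> int" where
  "deg X = 0"
| "deg Xi = -1"

definition wdeg :: "word \<Rightarrow> int" where
  "wdeg w = sum_list (map deg w)"

definition mdeg :: "word list \<Rightarrow> int" where
  "mdeg ws = sum_list (map wdeg ws)"

text \<open>The sign \<open>(-1)\<close> to the power \<open>n\<close>, for an integer (possibly negative) degree \<open>n\<close>.\<close>

definition ksign :: "int \<Rightarrow> complex" where
  "ksign n = (if even n then 1 else -1)"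

fun inv_pairing :: "letter \<Rightarrow> letter \<Rightarrow> complex" where
  "inv_pairing X Xi = 1"
| "inv_pairing Xi X = 1"
| "inv_pairing X X = 0"
| "inv_pairing Xi Xi = 0"

fun letter_diff :: "letter \<Rightarrow> (letter \<Rightarrow>\<^sub>0 complex)" where
  "letter_diff X = 0"
| "letter_diff Xi = - basis X"


section \<open>The symmetric algebra on cyclic words\<close>

text \<open>
  A list \<open>[w1, ..., wn]\<close> of words stands for the product of the cyclic words \<open>w1, ..., wn\<close>.
  The graded symmetric algebra on the space of cyclic words is the quotient of the free vector
  space on such lists by the span \<open>rel_space\<close> of the relations below: the coinvariants for the
  cyclic rotations of each word and for the permutations of the words, both acting with Koszul
  signs (adjacent transpositions and one-step rotations generate these actions).  In particular
  cyclic words such as \<open>[Xi, Xi]\<close>, and squares of odd cyclic words, vanish in the quotient.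
  The empty word \<open>[]\<close> is \<open>\<nu>\<close>; the empty list of words is the unit of the algebra.
\<close>

type_synonym chain = "word list \<Rightarrow>\<^sub>0 complex"

definition rotation_relators :: "chain set" where
  "rotation_relators =
     {basis (us @ (l # w) # vs)
        - scale (ksign (deg l * wdeg w)) (basis (us @ (w @ [l]) # vs)) | us l w vs. True}"

definition swap_relators :: "chain set" where
  "swap_relators =
     {basis (us @ a # b # vs)
        - scale (ksign (wdeg a * wdeg b)) (basis (us @ b # a # vs)) | us a b vs. True}"

definition rel_space :: "chain set" where
  "rel_space = free.span (rotation_relators \<union> swap_relators)"


section \<open>Bracket, cobracket and the differential\<close>

text \<open>
  All signs are Koszul signs.  In \<open>bracket\<close> and \<open>cobracket\<close> the sign is the one of the
  rearrangement of the letters that moves the two contracted letters to the front and puts the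
  remaining ones in the order in which they appear in the result:
  \<open>A1 x A2 B1 y B2\<close> becomes \<open>x y A2 A1 B2 B1\<close> in the bracket, and
  \<open>U x M y V\<close> becomes \<open>x y M V U\<close> in the cobracket.  List positions count from \<open>0\<close>.
\<close>

definition bracket :: "word \<Rightarrow> word \<Rightarrow> (word \<Rightarrow>\<^sub>0 complex)" where
  "bracket a b =
     (\<Sum>i<length a. \<Sum>j<length b.
        let A1 = take i a; A2 = drop (i + 1) a; B1 = take j b; B2 = drop (j + 1) b;
            x = a ! i; y = b ! j
        in scale (ksign (wdeg A1 * (deg x + wdeg A2)
                         + wdeg B1 * (deg y + wdeg B2)
                         + deg y * (wdeg A2 + wdeg A1))
                  * inv_pairing x y)
                 (basis (A2 @ A1 @ B2 @ B1)))"

definition cobracket :: "word \<Rightarrow> chain" where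
  "cobracket a =
     (\<Sum>j<length a. \<Sum>i<j.
        let U = take i a; M = drop (i + 1) (take j a); V = drop (j + 1) a;
            x = a ! i; y = a ! j
        in scale (ksign (wdeg U * (deg x + wdeg M + deg y + wdeg V) + deg y * wdeg M)
                  * inv_pairing x y)
                 (basis [M, V @ U]))"

definition word_diff :: "word \<Rightarrow> (word \<Rightarrow>\<^sub>0 complex)" where
  "word_diff a =
     (\<Sum>i<length a. scale (ksign (wdeg (take i a)))
        (lin_ext (\<lambda>l. basis (a[i := l])) (letter_diff (a ! i))))"

text \<open>The operators \<open>d\<close>, \<open>\<nabla>\<close> (odd derivations) and \<open>\<delta>\<close> on products of words.\<close>

definition d_op :: "word list \<Rightarrow> chain" where
  "d_op ws =
     (\<Sum>i<length ws. scale (ksign (mdeg (take i ws)))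
        (lin_ext (\<lambda>w. basis (ws[i := w])) (word_diff (ws ! i))))"

definition nabla_op :: "word list \<Rightarrow> chain" where
  "nabla_op ws =
     (\<Sum>i<length ws. scale (ksign (mdeg (take i ws)))
        (lin_ext (\<lambda>vs. basis (take i ws @ vs @ drop (i + 1) ws)) (cobracket (ws ! i))))"

definition delta_op :: "word list \<Rightarrow> chain" where
  "delta_op ws =
     (\<Sum>j<length ws. \<Sum>i<j.
        let U = take i ws; M = drop (i + 1) (take j ws); V = drop (j + 1) ws;
            a = ws ! i; b = ws ! j
        in scale (ksign (wdeg a * mdeg U + wdeg b * (mdeg U + mdeg M)))
             (lin_ext (\<lambda>w. basis (w # U @ M @ V)) (bracket a b)))"

definition differential :: "chain \<Rightarrow> chain" where
  "differential = lin_ext (\<lambda>ws. d_op ws + delta_op ws + nabla_op ws)"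


section \<open>Cohomology classes and the polynomials\<close>

text \<open>
  Two chains are cohomologous if their images in the quotient by \<open>rel_space\<close> differ by a
  boundary.
\<close>

definition cohomologous :: "chain \<Rightarrow> chain \<Rightarrow> bool" where
  "cohomologous z z' \<longleftrightarrow> (\<exists>y. (z - z') - differential y \<in> rel_space)"

definition nu_poly :: "complex poly \<Rightarrow> chain" where
  "nu_poly p = (\<Sum>m\<le>degree p. scale (coeff p m) (basis (replicate m [])))"

definition x_power :: "nat \<Rightarrow> chain" where
  "x_power i = basis [replicate i X]"

definition represents :: "complex poly \<Rightarrow> nat \<Rightarrow> bool" where
  "represents p i \<longleftrightarrow> cohomologous (x_power i) (nu_poly p)"

definition hz_poly :: "nat \<Rightarrow> complex poly" where
  "hz_poly i = (THE p. represents p i)"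

end

theory Submission
  imports Defs "HOL-Library.Multiset" "HOL-Computational_Algebra.Formal_Power_Series"
begin

text \<open>
  Sending a product of words \<open>x^{n\<^sub>1}, \<dots>, x^{n\<^sub>r}\<close> to the Gaussian matrix correlator
  \<open>\<langle>tr M^{n\<^sub>1} \<dots> tr M^{n\<^sub>r}\<rangle>\<close>, with \<open>\<nu>\<close> in the place of the matrix size, and every product
  containing \<open>\<xi>\<close> to \<open>0\<close> kills the boundaries precisely because of the loop (Schwinger--Dyson)
  equations.  Hence \<open>p\<^sub>i\<close> is the one-point correlator of \<open>tr M^i\<close>.  The correlators are
  constructed by solving the loop equations recursively; that they are well defined amounts to
  the Virasoro commutation relations.

  To compute the one-point correlators, one applies the loop equations to the products of a
  complete and a (signed) elementary symmetric function of \<open>M\<close>, on which they close up to a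
  recurrence with an explicit solution.  Newton's identity
  \<open>tr M^n = \<Sum>\<^sub>i i h\<^sub>i (-1)^{n-i} e\<^bsub>n-i\<^esub>\<close> then gives
  \<open>p\<^bsub>2k\<^esub>(\<nu>) = (2k-1)!! (S + 1)^k (\<nu> choose k + 1)\<close>, \<open>S\<close> being the shift of \<open>\<nu>\<close> by one, from
  which the recurrence is read off.
\<close>

text \<open>That \<nu>-polynomials represent all classes uniquely is not presupposed: existence of
  p_i comes from pushing products of x-words down to shorter ones by boundaries, uniqueness from
  evaluating at every complex \<nu>. The obstacle in the computation is that the loop equation of a
  single trace produces products of two traces, so one-point correlators alone satisfy no closed
  system. Weighting the equation for \<open>p_{n+1}\<close> with \<open>h_{K-n}\<close> and summing
  over n cures this: the split terms and the derivative of h recombine, by Newton's identity, into a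
  multiple of \<open>h_{K-1}\<close>. Reaching tr M^n takes products of h and e, and then the
  derivative of the second factor leaves a mixed sum that is no such correlator. Only the difference
  of two neighbouring mixed sums of equal total degree is one, which is why the recurrence links the
  positions (K+1, j+1) and (K+2, j). The shape of the solution comes from Schur functions: the
  Gaussian correlator of a hook is a rational multiple of the product of \<nu> + c over its contents
  c, that is, of a binomial coefficient in \<nu> shifted by the arm. Signed sums over hooks then
  become powers of S^2 - 1.\<close>

lemma lookup_basis: "Poly_Mapping.lookup (basis k) j = (if j = k then 1 else 0)"
  by (simp add: basis_def lookup_single when_def)

lemma keys_basis [simp]: "Poly_Mapping.keys (basis k) = {k}"
  by (simp add: basis_def)

lemma free_expansion:
  "z = (\<Sum>k\<in>Poly_Mapping.keys z. scale (Poly_Mapping.lookup z k) (basis k))"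
  by (rule poly_mapping_eqI)
    (auto simp: lookup_sum lookup_basis if_distrib sum.delta in_keys_iff cong: if_cong)

lemma free_induct [case_names zero basis add scale]:
  assumes "P 0" "\<And>k. P (basis k)" "\<And>x y. P x \<Longrightarrow> P y \<Longrightarrow> P (x + y)"
    "\<And>c x. P x \<Longrightarrow> P (scale c x)"
  shows "P z"
proof -
  have "P (\<Sum>k\<in>K. scale (Poly_Mapping.lookup z k) (basis k))" if "finite K" for K
    using that by (induction K) (auto intro: assms)
  then show ?thesis
    by (subst free_expansion) simp
qed

lemma lin_ext_superset:
  assumes "finite K" "Poly_Mapping.keys z \<subseteq> K"
  shows "lin_ext f z = (\<Sum>k\<in>K. scale (Poly_Mapping.lookup z k) (f k))"
  unfolding lin_ext_def using assms
  by (intro sum.mono_neutral_left) (auto simp: in_keys_iff)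

lemma lin_ext_add: "lin_ext f (x + y) = lin_ext f x + lin_ext f y"
proof -
  let ?K = "Poly_Mapping.keys x \<union> Poly_Mapping.keys y"
  have "Poly_Mapping.keys (x + y) \<subseteq> ?K"
    by (rule keys_add)
  then show ?thesis
    by (simp add: lin_ext_superset[of ?K] lookup_add free.scale_left_distrib sum.distrib)
qed

lemma lin_ext_scale: "lin_ext f (scale c x) = scale c (lin_ext f x)"
proof -
  have "Poly_Mapping.keys (scale c x) \<subseteq> Poly_Mapping.keys x"
    by (auto simp: in_keys_iff)
  then show ?thesis
    by (simp add: lin_ext_superset[of "Poly_Mapping.keys x"] free.scale_sum_right)
qed

lemma lin_ext_basis [simp]: "lin_ext f (basis k) = f k"
  by (simp add: lin_ext_def lookup_basis)

lemma lin_ext_zero [simp]: "lin_ext f 0 = 0"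
  by (simp add: lin_ext_def)

lemma lin_ext_uminus: "lin_ext f (- x) = - lin_ext f x"
  using lin_ext_add[of f x "- x"] by (simp add: eq_neg_iff_add_eq_0 add.commute)

lemma lin_ext_sum: "lin_ext f (sum g S) = (\<Sum>s\<in>S. lin_ext f (g s))"
  by (induction S rule: infinite_finite_induct) (simp_all add: lin_ext_add)

section \<open>Linear functionals on free vector spaces\<close>

definition lin :: "('a \<Rightarrow> complex) \<Rightarrow> ('a \<Rightarrow>\<^sub>0 complex) \<Rightarrow> complex" where
  "lin f z = (\<Sum>k\<in>Poly_Mapping.keys z. Poly_Mapping.lookup z k * f k)"

lemma lin_superset:
  assumes "finite K" "Poly_Mapping.keys z \<subseteq> K"
  shows "lin f z = (\<Sum>k\<in>K. Poly_Mapping.lookup z k * f k)"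
  unfolding lin_def using assms
  by (intro sum.mono_neutral_left) (auto simp: in_keys_iff)

lemma lin_add: "lin f (x + y) = lin f x + lin f y"
proof -
  let ?K = "Poly_Mapping.keys x \<union> Poly_Mapping.keys y"
  have "Poly_Mapping.keys (x + y) \<subseteq> ?K"
    by (rule keys_add)
  then show ?thesis
    by (simp add: lin_superset[of ?K] lookup_add ring_distribs sum.distrib)
qed

lemma lin_scale: "lin f (scale c x) = c * lin f x"
proof -
  have "Poly_Mapping.keys (scale c x) \<subseteq> Poly_Mapping.keys x"
    by (auto simp: in_keys_iff)
  then show ?thesis
    by (simp add: lin_superset[of "Poly_Mapping.keys x"] sum_distrib_left mult.assoc)
qed

lemma lin_basis [simp]: "lin f (basis k) = f k"
  by (simp add: lin_def lookup_basis)

lemma lin_zero [simp]: "lin f 0 = 0"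
  by (simp add: lin_def)

lemma lin_uminus: "lin f (- x) = - lin f x"
  using lin_add[of f x "- x"] by (simp add: eq_neg_iff_add_eq_0 add.commute)

lemma lin_diff: "lin f (x - y) = lin f x - lin f y"
  using lin_add[of f x "- y"] by (simp add: lin_uminus)

lemma lin_sum: "lin f (sum g S) = (\<Sum>s\<in>S. lin f (g s))"
  by (induction S rule: infinite_finite_induct) (simp_all add: lin_add)

lemma lin_sum_mset: "lin f (\<Sum>x\<in>#M. g x) = (\<Sum>x\<in>#M. lin f (g x))"
  by (induction M) (simp_all add: lin_add)

lemma lin_lin_ext: "lin f (lin_ext g z) = lin (\<lambda>k. lin f (g k)) z"
  by (induction z rule: free_induct) (simp_all add: lin_add lin_scale lin_ext_add lin_ext_scale)

lemma lin_cong: "(\<And>k. k \<in> Poly_Mapping.keys z \<Longrightarrow> f k = g k) \<Longrightarrow> lin f z = lin g z"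
  unfolding lin_def by (rule sum.cong) auto


section \<open>Virasoro operators on the ring of traces\<close>

text \<open>Multisets under union form a free commutative monoid, so the convolution product of
  \<open>poly_mapping\<close> makes this the polynomial ring in \<open>ptr 0\<close>,
  \<open>ptr 1\<close>, ... The matrix size stays a formal variable here; \<open>gue_add_0\<close>
  turns it into the number \<nu>.\<close>

type_synonym trace_ring = "nat multiset \<Rightarrow>\<^sub>0 complex"

abbreviation const :: "complex \<Rightarrow> trace_ring" where
  "const c \<equiv> Poly_Mapping.single 0 c"

lemma scale_conv_mult: "scale c F = const c * F" for F :: trace_ring
  by (simp add: scale_def mult_map_scale_conv_mult)

lemma scale_mult_left: "scale c F * G = scale c (F * G)" for F :: trace_ring
  by (simp add: scale_conv_mult mult.assoc)

lemma scale_mult_right: "F * scale c G = scale c (F * G)" for F :: trace_ring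
  by (simp add: scale_conv_mult mult.left_commute)

lemma lin_const_mult: "lin f (const c * F) = c * lin f F"
  by (simp add: lin_scale flip: scale_conv_mult)

lemma lin_of_nat_mult: "lin f (of_nat n * F) = of_nat n * lin f F" for F :: trace_ring
  using lin_const_mult[of f "of_nat n" F] by simp

lemma basis_mult: "basis M * basis N = basis (M + N)" for M N :: "nat multiset"
  by (simp add: basis_def mult_single)

lemma basis_empty: "basis ({#} :: nat multiset) = 1"
  by (simp add: basis_def flip: zero_multiset_def)

text \<open>The generator \<open>ptr n\<close> stands for \<open>tr M^n\<close>; in particular \<open>ptr 0\<close> stands for \<open>\<nu>\<close>.\<close>

definition ptr :: "nat \<Rightarrow> trace_ring" where
  "ptr n = basis {#n#}"

lemma basis_add_mset: "basis (add_mset n M) = ptr n * basis M"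
  by (simp add: ptr_def basis_mult)

text \<open>The derivation \<open>\<Sum>\<^sub>m m p\<^bsub>n+m-1\<^esub> \<partial>/\<partial>p\<^sub>m\<close>.  The truncation of \<open>n + x - 1\<close> at \<open>n = x = 0\<close> is
  harmless because of the factor \<open>x\<close>.\<close>

definition vir_deriv :: "nat \<Rightarrow> trace_ring \<Rightarrow> trace_ring" where
  "vir_deriv n = lin_ext (\<lambda>M. \<Sum>x\<in>#M. of_nat x * basis (add_mset (n + x - 1) (M - {#x#})))"

lemma vir_deriv_add: "vir_deriv n (F + G) = vir_deriv n F + vir_deriv n G"
  by (simp add: vir_deriv_def lin_ext_add)

lemma vir_deriv_scale: "vir_deriv n (scale c F) = scale c (vir_deriv n F)"
  by (simp add: vir_deriv_def lin_ext_scale)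

lemma vir_deriv_zero [simp]: "vir_deriv n 0 = 0"
  by (simp add: vir_deriv_def)

lemma vir_deriv_sum: "vir_deriv n (sum g S) = (\<Sum>s\<in>S. vir_deriv n (g s))"
  by (simp add: vir_deriv_def lin_ext_sum)

lemma vir_deriv_basis:
  "vir_deriv n (basis M) = (\<Sum>x\<in>#M. of_nat x * basis (add_mset (n + x - 1) (M - {#x#})))"
  by (simp add: vir_deriv_def)

lemma vir_deriv_basis_union:
  "vir_deriv n (basis (M + N)) = vir_deriv n (basis M) * basis N
      + basis M * vir_deriv n (basis N)"
proof -
  have 1: "(\<Sum>x\<in>#M. of_nat x * basis (add_mset (n + x - 1) (M + N - {#x#})))
      = vir_deriv n (basis M) * basis N" for M N :: "nat multiset"
  proof -
    have "(\<Sum>x\<in>#M. of_nat x * basis (add_mset (n + x - 1) (M + N - {#x#})))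
      = (\<Sum>x\<in>#M. of_nat x * basis (add_mset (n + x - 1) (M - {#x#})) * basis N)"
      by (intro arg_cong[where f = sum_mset] image_mset_cong)
        (simp add: mult.assoc basis_mult add.commute union_mset_add_mset_right
            multiset_diff_union_assoc)
    then show ?thesis
      by (simp add: vir_deriv_basis sum_mset_distrib_right)
  qed
  show ?thesis
    using 1[of M N] 1[of N M] by (simp add: vir_deriv_basis add.commute[of N] mult.commute)
qed

lemma vir_deriv_mult: "vir_deriv n (F * G) = vir_deriv n F * G + F * vir_deriv n G"
proof (induction F rule: free_induct)
  case (basis M)
  show ?case
  proof (induction G rule: free_induct)
    case (basis N)
    show ?case by (simp add: basis_mult vir_deriv_basis_union)
  qed (simp_all add: vir_deriv_add vir_deriv_scale scale_mult_right free.scale_right_distrib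
      distrib_left)
qed (simp_all add: vir_deriv_add vir_deriv_scale scale_mult_left free.scale_right_distrib
    distrib_right)

lemma vir_deriv_one [simp]: "vir_deriv n 1 = 0"
  using vir_deriv_mult[of n 1 1] by simp

lemma vir_deriv_const_mult: "vir_deriv n (const c * F) = const c * vir_deriv n F"
  using vir_deriv_scale[of n c F] by (simp add: scale_conv_mult)

lemma vir_deriv_of_nat_mult: "vir_deriv n (of_nat k * F) = of_nat k * vir_deriv n F"
  using vir_deriv_const_mult[of n "of_nat k" F] by simp

lemma vir_deriv_ptr: "vir_deriv n (ptr m) = of_nat m * ptr (n + m - 1)"
  by (simp add: ptr_def vir_deriv_basis)

lemma derivation_eq_0:
  fixes \<delta> :: "trace_ring \<Rightarrow> trace_ring"
  assumes add: "\<And>F G. \<delta> (F + G) = \<delta> F + \<delta> G"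
    and scale: "\<And>c F. \<delta> (scale c F) = scale c (\<delta> F)"
    and mult: "\<And>F G. \<delta> (F * G) = \<delta> F * G + F * \<delta> G"
    and ptr: "\<And>k. \<delta> (ptr k) = 0"
  shows "\<delta> F = 0"
proof (induction F rule: free_induct)
  case zero
  show ?case using add[of 0 0] by simp
next
  case (basis M)
  show ?case
  proof (induction M)
    case empty
    show ?case using mult[of 1 1] by (simp add: basis_empty)
  next
    case (add k M)
    then show ?case by (simp add: basis_add_mset mult ptr)
  qed
qed (simp_all add: add scale)

text \<open>Both sides are derivations in \<open>F\<close>, so generators suffice. With
  \<open>vir_deriv n\<close> read as an operator of index n - 1 this is the Witt relation; the
  truncated index at n = m = 0 carries the factor 0.\<close>

lemma vir_deriv_commutator:
  "vir_deriv n (vir_deriv m F) - vir_deriv m (vir_deriv n F)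
    = (of_nat m - of_nat n) * vir_deriv (n + m - 1) F"
proof -
  define \<delta> where "\<delta> F = vir_deriv n (vir_deriv m F) - vir_deriv m (vir_deriv n F)
    - (of_nat m - of_nat n) * vir_deriv (n + m - 1) F" for F
  have "\<delta> F = 0"
  proof (rule derivation_eq_0[where \<delta> = \<delta>])
    fix k
    show "\<delta> (ptr k) = 0"
    \<comment> \<open>In the first case all terms vanish or cancel; in the second no subtraction
      truncates.\<close>
    proof (cases "k = 0 \<or> n + m = 0")
      case True
      then show ?thesis by (auto simp: \<delta>_def vir_deriv_ptr)
    next
      case False
      then have "n + (m + k - 1) - 1 = n + m + k - 2" "m + (n + k - 1) - 1 = n + m + k - 2"
        "n + m - 1 + k - 1 = n + m + k - 2"
        by auto
      moreover have "of_nat (m + k - 1) = (of_nat m + of_nat k - 1 :: trace_ring)"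
        "of_nat (n + k - 1) = (of_nat n + of_nat k - 1 :: trace_ring)"
        using False by (auto simp: of_nat_diff)
      ultimately show ?thesis
        by (simp only: \<delta>_def vir_deriv_ptr vir_deriv_of_nat_mult) (simp add: algebra_simps)
    qed
  next
    fix c F
    show "\<delta> (scale c F) = scale c (\<delta> F)"
      by (simp add: \<delta>_def vir_deriv_scale scale_mult_right free.scale_right_diff_distrib)
  qed (simp_all add: \<delta>_def vir_deriv_add vir_deriv_mult algebra_simps)
  then show ?thesis by (simp add: \<delta>_def)
qed

definition split_sum :: "nat \<Rightarrow> trace_ring" where
  "split_sum n = (\<Sum>a<n. ptr a * ptr (n - 1 - a))"

text \<open>The loop equations read \<open>\<langle>p\<^bsub>n+1\<^esub> F\<rangle> = \<langle>loop n F\<rangle>\<close>.\<close>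

definition loop :: "nat \<Rightarrow> trace_ring \<Rightarrow> trace_ring" where
  "loop n F = split_sum n * F + vir_deriv n F"

lemma loop_add: "loop n (F + G) = loop n F + loop n G"
  by (simp add: loop_def vir_deriv_add algebra_simps)

lemma loop_scale: "loop n (scale c F) = scale c (loop n F)"
  by (simp add: loop_def vir_deriv_scale scale_mult_right free.scale_right_distrib)

lemma loop_zero [simp]: "loop n 0 = 0"
  by (simp add: loop_def)


section \<open>Gaussian correlators and the loop equations\<close>

text \<open>Records that the calls of \<open>gue\<close> under \<open>image_mset\<close> are made
  for members of the multiset only, which the termination proof uses.\<close>

lemma image_mset_fundef_cong [fundef_cong]:
  "M = N \<Longrightarrow> (\<And>x. x \<in># N \<Longrightarrow> f x = g x) \<Longrightarrow> image_mset f M = image_mset g N"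
  by (auto intro: image_mset_cong)

text \<open>The loop equation is imposed only for a largest positive entry; the others follow
  (\<open>gue_loop_basis\<close>).\<close>

function gue :: "complex \<Rightarrow> nat multiset \<Rightarrow> complex" where
  "gue \<nu> M =
     (if \<forall>x\<in>#M. x = 0 then \<nu> ^ size M
      else let m = Max (set_mset M); N = M - {#m#} in
        (\<Sum>a<m - 1. gue \<nu> (add_mset a (add_mset (m - 1 - 1 - a) N)))
        + (\<Sum>x\<in>#N. of_nat x * gue \<nu> (add_mset (m - 1 + x - 1) (N - {#x#}))))"
  by pat_completeness auto

lemma Max_mset_pos:
  fixes M :: "nat multiset"
  assumes "\<not> (\<forall>x\<in>#M. x = 0)"
  shows "Max (set_mset M) \<in># M" "Max (set_mset M) > 0"
proof -
  obtain x where x: "x \<in># M" "x > 0" using assms by auto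
  then show "Max (set_mset M) \<in># M" by (intro Max_in) auto
  from x show "Max (set_mset M) > 0" by (metis Max_ge finite_set_mset less_le_trans)
qed

lemma sum_mset_diff_Max:
  fixes M :: "nat multiset"
  assumes "\<not> (\<forall>x\<in>#M. x = 0)"
  shows "sum_mset M = Max (set_mset M) + sum_mset (M - {#Max (set_mset M)#})"
  using Max_mset_pos(1)[OF assms] by (rule sum_mset.remove)

termination
\<comment> \<open>The weight drops: the indices produced add up to \<open>m - 2\<close> when a trace
  is cut and, up to truncation, to \<open>m + x - 2\<close> when two traces are joined.\<close>
proof (relation "measure (\<lambda>(_, M). sum_mset M)", goal_cases)
  case (2 \<nu> M m N a)
  then show ?case
    using sum_mset_diff_Max[of M] by simp
next
  case (3 \<nu> M m N x)
  then show ?case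
    using sum_mset_diff_Max[of M] Max_mset_pos(2)[of M] sum_mset.remove[of x N] by simp
qed simp

declare gue.simps [simp del]

lemma loop_basis:
  "loop n (basis M) = (\<Sum>a<n. basis (add_mset a (add_mset (n - 1 - a) M)))
     + (\<Sum>x\<in>#M. of_nat x * basis (add_mset (n + x - 1) (M - {#x#})))"
  by (simp add: loop_def split_sum_def sum_distrib_right basis_add_mset vir_deriv_basis
      mult.assoc)

lemma lin_loop_basis:
  "lin f (loop n (basis M)) = (\<Sum>a<n. f (add_mset a (add_mset (n - 1 - a) M)))
     + (\<Sum>x\<in>#M. of_nat x * f (add_mset (n + x - 1) (M - {#x#})))"
  by (simp add: loop_basis lin_add lin_sum lin_sum_mset lin_of_nat_mult
      image_mset.compositionality
      comp_def)

lemma gue_zeros: "(\<And>x. x \<in># M \<Longrightarrow> x = 0) \<Longrightarrow> gue \<nu> M = \<nu> ^ size M"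
  by (subst gue.simps) auto

lemma gue_Max:
  assumes "\<not> (\<forall>x\<in>#M. x = 0)"
  defines "m \<equiv> Max (set_mset M)"
  shows "gue \<nu> M = lin (gue \<nu>) (loop (m - 1) (basis (M - {#m#})))"
  unfolding lin_loop_basis gue.simps[of \<nu> M] m_def
  by (simp only: assms(1) if_False Let_def)

lemma keys_sum_mset: "Poly_Mapping.keys (\<Sum>x\<in>#M. f x) \<subseteq> (\<Union>x\<in>set_mset M. Poly_Mapping.keys (f x))"
proof (induction M)
  case (add x M)
  then show ?case using keys_add[of "f x" "\<Sum>x\<in>#M. f x"] by auto
qed auto

lemma keys_of_nat_mult_basis:
  "Poly_Mapping.keys (of_nat x * basis M :: trace_ring) = (if x = 0 then {} else {M})"
proof -
  have "of_nat x * basis M = Poly_Mapping.single M (of_nat x)"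
    by (simp add: basis_def mult_single flip: single_of_nat)
  then show ?thesis by simp
qed

text \<open>\<open>loop n\<close> replaces a factor of weight \<open>n + 1\<close>. That it strictly
  lowers the weight justifies induction hypotheses applied to \<open>loop n (basis M)\<close>, which
  is no longer a single monomial.\<close>

lemma weight_loop_basis:
  assumes "N \<in> Poly_Mapping.keys (loop n (basis M))"
  shows "sum_mset N < n + sum_mset M"
proof -
  let ?A = "\<Sum>a<n. basis (add_mset a (add_mset (n - 1 - a) M)) :: trace_ring"
  let ?B = "\<Sum>x\<in>#M. of_nat x * basis (add_mset (n + x - 1) (M - {#x#})) :: trace_ring"
  have "N \<in> Poly_Mapping.keys ?A \<union> Poly_Mapping.keys ?B"
    using assms keys_add[of ?A ?B] unfolding loop_basis by blast
  then consider "N \<in> Poly_Mapping.keys ?A" | "N \<in> Poly_Mapping.keys ?B" by auto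
  then show ?thesis
  proof cases
    case 1
    then obtain a where "a < n" "N = add_mset a (add_mset (n - 1 - a) M)"
      using keys_sum[of "\<lambda>a. basis (add_mset a (add_mset (n - 1 - a) M)) :: trace_ring" "{..<n}"]
      by auto
    then show ?thesis by simp
  next
    case 2
    \<comment> \<open>The condition \<open>x \<noteq> 0\<close> comes from the coefficient
      \<open>of_nat x\<close>; for \<open>n = x = 0\<close> the weight would not drop.\<close>
    then obtain x where "x \<in># M" "x \<noteq> 0" "N = add_mset (n + x - 1) (M - {#x#})"
      using keys_sum_mset[of "\<lambda>x. of_nat x * basis (add_mset (n + x - 1) (M
          - {#x#})) :: trace_ring" M]
      by (auto simp: keys_of_nat_mult_basis split: if_splits)
    then show ?thesis by (simp add: sum_mset.remove[of x M])
  qed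
qed

text \<open>The factor 2 appears because the two sums given by the Leibniz rule are exchanged by the
  reflection of \<open>a\<close> to \<open>m - 1 - a\<close>.\<close>

lemma vir_deriv_split_sum:
  "vir_deriv n (split_sum m) = 2 * (\<Sum>j<m. of_nat (m - 1 - j) * (ptr j * ptr (n + m - 1 - 1 - j)))"
proof -
  have "(\<Sum>a<m. of_nat a * (ptr (n + a - 1) * ptr (m - 1 - a)))
      = (\<Sum>j<m. of_nat (m - 1 - j) * (ptr j * ptr (n + m - 1 - 1 - j)))"
  proof (rule sum.reindex_bij_witness[of _ "\<lambda>a. m - 1 - a" "\<lambda>a. m - 1 - a"])
    fix a assume "a \<in> {..<m}"
    then have "m - 1 - (m - 1 - a) = a" "n + m - 1 - 1 - (m - 1 - a) = n + a - 1"
      by auto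
    then show "of_nat (m - 1 - (m - 1 - a)) *
        (ptr (m - 1 - a) * ptr (n + m - 1 - 1 - (m - 1 - a)))
        = of_nat a * (ptr (n + a - 1) * ptr (m - 1 - a))"
      by (simp only: mult.commute)
  qed auto
  moreover have "(\<Sum>a<m. ptr a * (of_nat (m - 1 - a) * ptr (n + (m - 1 - a) - 1)))
      = (\<Sum>j<m. of_nat (m - 1 - j) * (ptr j * ptr (n + m - 1 - 1 - j)))"
  proof (rule sum.cong)
    fix a assume "a \<in> {..<m}"
    then have "n + m - 1 - 1 - a = n + (m - 1 - a) - 1 \<or> m - 1 - a = 0"
      by auto
    then show "ptr a * (of_nat (m - 1 - a) * ptr (n + (m - 1 - a) - 1))
        = of_nat (m - 1 - a) * (ptr a * ptr (n + m - 1 - 1 - a))"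
      by (auto simp only: mult.left_commute of_nat_0 mult_zero_left mult_zero_right)
  qed simp
  ultimately show ?thesis
    by (simp only: split_sum_def vir_deriv_sum vir_deriv_mult vir_deriv_ptr sum.distrib mult_2
        mult.assoc)
qed

text \<open>Both derivatives are sums of the same products \<open>f j\<close>, whose indices add up
  to \<open>T - 1\<close> and which are invariant under reflection of \<open>j\<close>. The
  difference has a coefficient linear in \<open>j\<close>; averaged with its reflection it becomes
  the constant (m - n) / 2, and the factor 2 of \<open>vir_deriv_split_sum\<close> clears the
  denominator.\<close>

lemma split_sum_commutator:
  "vir_deriv n (split_sum m) - vir_deriv m (split_sum n)
    = (of_nat m - of_nat n) * split_sum (n + m - 1)"
proof (cases "n + m = 0")
  case True
  then show ?thesis by (simp add: split_sum_def)
next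
  case False
  define f where "f j = ptr j * ptr (n + m - 1 - 1 - j)" for j
  define T where "T = n + m - 1"
  have T: "T + 1 = n + m" using False by (simp add: T_def)
  have f_refl: "f (T - 1 - j) = f j" if "j < T" for j
  proof -
    have "n + m - 1 - 1 - (T - 1 - j) = j" "T - 1 - j = n + m - 1 - 1 - j"
      using that by (auto simp: T_def)
    then show ?thesis by (simp only: f_def mult.commute)
  qed
  have A: "(\<Sum>j<m. of_nat (m - 1 - j) * f j)
      = (\<Sum>j<T. (if j < m then of_nat m - 1 - of_nat j else 0) * f j)"
  proof -
    have "(\<Sum>j<m. of_nat (m - 1 - j) * f j)
        = (\<Sum>j<m. (if j < T \<and> j < m then of_nat m - 1 - of_nat j else 0) * f j)"
    proof (intro sum.cong refl)
      fix j assume "j \<in> {..<m}"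
      then have "j < m" "j < T \<or> m - 1 - j = 0" using T by auto
      then show "of_nat (m - 1 - j) * f j
          = (if j < T \<and> j < m then of_nat m - 1 - of_nat j else 0) * f j"
        by (cases "j < T") (simp_all add: of_nat_diff algebra_simps del: diff_is_0_eq)
    qed
    also have "\<dots> = (\<Sum>j<T+m. (if j < T \<and> j < m then of_nat m - 1 - of_nat j else 0) * f j)"
      by (intro sum.mono_neutral_left) auto
    also have "\<dots> = (\<Sum>j<T. (if j < T \<and> j < m then of_nat m - 1 - of_nat j else 0) * f j)"
      by (intro sum.mono_neutral_right) auto
    finally show ?thesis by (simp cong: if_cong)
  qed
  \<comment> \<open>After reflection this sum occupies the indices from \<open>m\<close> on, with
    minus the coefficient \<open>m - 1 - j\<close> found in \<open>A\<close>. The difference of the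
    two is therefore a single linear sum over \<open>{..<T}\<close>.\<close>
  have B: "(\<Sum>j<n. of_nat (n - 1 - j) * f j)
      = (\<Sum>j<T. (if j < m then 0 else of_nat j + 1 - of_nat m) * f j)"
  proof -
    have "(\<Sum>j<n. of_nat (n - 1 - j) * f j) = (\<Sum>j<n - 1. of_nat (n - 1 - j) * f j)"
    proof (intro sum.mono_neutral_right ballI)
      fix j assume "j \<in> {..<n} - {..<n - 1}"
      then have "n - 1 - j = 0" by auto
      then show "of_nat (n - 1 - j) * f j = 0" by (simp only: of_nat_0 mult_zero_left)
    qed auto
    also have "\<dots> = (\<Sum>j\<in>{m..<T}. (of_nat j + 1 - of_nat m) * f j)"
    proof (rule sum.reindex_bij_witness[of _ "\<lambda>j. T - 1 - j" "\<lambda>j. T - 1 - j"])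
      fix j assume j: "j \<in> {..<n - 1}"
      then have "n - 1 - j + m = T - 1 - j + 1" "j < T" using T by auto
      then have "of_nat (n - 1 - j) + of_nat m = (of_nat (T - 1 - j) + 1 :: trace_ring)"
        by (metis of_nat_add of_nat_1)
      then have "of_nat (T - 1 - j) + 1 - of_nat m = (of_nat (n - 1 - j) :: trace_ring)"
        by (simp only: diff_eq_eq)
      with f_refl[OF \<open>j < T\<close>]
      show "(of_nat (T - 1 - j) + 1 - of_nat m) * f (T - 1 - j) = of_nat (n - 1 - j) * f j"
        by (simp only:)
    qed (use T in auto)
    also have "\<dots> = (\<Sum>j\<in>{m..<T}. (if j < m then 0 else of_nat j + 1 - of_nat m) * f j)"
      by (intro sum.cong) auto
    also have "\<dots> = (\<Sum>j<T. (if j < m then 0 else of_nat j + 1 - of_nat m) * f j)"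
      by (intro sum.mono_neutral_left) auto
    finally show ?thesis .
  qed
  have "(\<Sum>j<m. of_nat (m - 1 - j) * f j) - (\<Sum>j<n. of_nat (n - 1 - j) * f j)
      = (\<Sum>j<T. (of_nat m - 1 - of_nat j) * f j)" (is "?D = ?S")
    unfolding A B sum_subtractf[symmetric] by (intro sum.cong) (auto simp: algebra_simps)
  moreover have "?S = (\<Sum>j<T. (of_nat m - of_nat T + of_nat j) * f j)"
  proof (rule sum.reindex_bij_witness[of _ "\<lambda>j. T - 1 - j" "\<lambda>j. T - 1 - j"])
    fix j assume j: "j \<in> {..<T}"
    then show "(of_nat m - of_nat T + of_nat (T - 1 - j)) * f (T - 1 - j)
        = (of_nat m - 1 - of_nat j) * f j"
      by (simp add: f_refl[simplified] of_nat_diff algebra_simps)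
  qed auto
  ultimately have "2 * ?D = (\<Sum>j<T. (of_nat m - 1 - of_nat j) * f j
      + (of_nat m - of_nat T + of_nat j) * f j)"
    by (simp add: sum.distrib)
  also have "\<dots> = (\<Sum>j<T. (of_nat m - of_nat n) * f j)"
  proof (intro sum.cong refl)
    fix j
    have "of_nat T + 1 = (of_nat n + of_nat m :: trace_ring)"
      using T by (metis of_nat_add of_nat_1)
    then have "of_nat T = (of_nat n + of_nat m - 1 :: trace_ring)" by (simp add: eq_diff_eq)
    then show "(of_nat m - 1 - of_nat j) * f j + (of_nat m - of_nat T + of_nat j) * f j
        = (of_nat m - of_nat n) * f j"
      by (simp only:) (simp add: algebra_simps)
  qed
  also have "\<dots> = (of_nat m - of_nat n) * split_sum T"
    by (simp add: split_sum_def f_def T_def sum_distrib_left)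
  finally show ?thesis
    by (simp add: vir_deriv_split_sum f_def T_def add.commute algebra_simps)
qed

text \<open>The products of two split sums and the mixed terms cancel. The two commutators that
  remain have the same structure constant, so no central term appears.\<close>

lemma loop_commutator:
  "loop n (loop m F) - loop m (loop n F) = (of_nat m - of_nat n) * loop (n + m - 1) F"
proof -
  have "loop n (loop m F) - loop m (loop n F)
      = (vir_deriv n (split_sum m) - vir_deriv m (split_sum n)) * F
        + (vir_deriv n (vir_deriv m F) - vir_deriv m (vir_deriv n F))"
    by (simp add: loop_def vir_deriv_add vir_deriv_mult algebra_simps)
  then show ?thesis
    by (simp add: split_sum_commutator vir_deriv_commutator loop_def algebra_simps)
qed

lemma loop_ptr_mult:
  "loop n (ptr m * F) = ptr m * loop n F + of_nat m * (ptr (n + m - 1) * F)"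
  by (simp add: loop_def vir_deriv_mult vir_deriv_ptr algebra_simps)

lemma lin_ptr_mult: "lin f (ptr m * F) = lin (\<lambda>M. f (add_mset m M)) F"
  by (induction F rule: free_induct)
    (simp_all add: distrib_left scale_mult_right lin_add lin_scale flip: basis_add_mset)

lemma lin_loop: "lin f (loop n F) = lin (\<lambda>M. lin f (loop n (basis M))) F"
  by (induction F rule: free_induct) (simp_all add: loop_add loop_scale lin_add lin_scale)

text \<open>Let \<open>m + 1\<close> be the largest entry, for which the equation holds by
  definition. Eliminating the traces \<open>m + 1\<close> and \<open>n + 1\<close> in either order
  gives two expressions that differ by the commutator, which the loop equation for
  \<open>n + m\<close> turns into \<open>m - n\<close> times \<open>ptr (n + m)\<close>. This is
  compensated exactly by the coefficients \<open>n + 1\<close> and \<open>m + 1\<close> of the terms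
  in which the two traces join.\<close>

lemma gue_loop_basis:
  "gue \<nu> (add_mset (Suc n) M) = lin (gue \<nu>) (loop n (basis M))"
proof (induction "Suc n + sum_mset M" arbitrary: n M rule: less_induct)
  case less
  have IH: "lin (gue \<nu>) (ptr (Suc k) * F) = lin (gue \<nu>) (loop k F)"
    if "\<And>N. N \<in> Poly_Mapping.keys F \<Longrightarrow> Suc k + sum_mset N < Suc n + sum_mset M" for k F
    unfolding lin_ptr_mult[of _ "Suc k"] lin_loop[of _ k F]
    by (intro lin_cong less) (use that in auto)
  let ?M = "add_mset (Suc n) M"
  define m where "m = Max (set_mset ?M) - 1"
  have nz: "\<not> (\<forall>x\<in>#?M. x = 0)" by simp
  have m: "Max (set_mset ?M) = Suc m" using Max_mset_pos[OF nz] by (simp add: m_def)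
  have def: "gue \<nu> ?M = lin (gue \<nu>) (loop m (basis (?M - {#Suc m#})))"
    using gue_Max[OF nz, of \<nu>] unfolding m by simp
  show ?case
  proof (cases "m = n")
    case True
    then show ?thesis using def by simp
  next
    case False
    then have "Suc m \<in># M" using Max_mset_pos(1)[OF nz] unfolding m by auto
    then obtain G where M: "M = add_mset (Suc m) G" by (metis multi_member_split)
    let ?E = "lin (gue \<nu>)"
    let ?G = "basis G :: trace_ring"
    have "gue \<nu> ?M = ?E (loop m (ptr (Suc n) * ?G))"
      using def unfolding M by (simp flip: basis_add_mset)
    also have "\<dots> = ?E (ptr (Suc n) * loop m ?G) + of_nat (Suc n) * ?E (ptr (m + n) * ?G)"
      by (simp only: loop_ptr_mult lin_add lin_of_nat_mult) simp
    also have "?E (ptr (Suc n) * loop m ?G) = ?E (loop n (loop m ?G))"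
      by (rule IH) (use weight_loop_basis in \<open>fastforce simp: M\<close>)
    finally have 1: "gue \<nu> ?M = ?E (loop n (loop m ?G)) + of_nat (Suc n) * ?E (ptr (n + m) * ?G)"
      by (simp add: add.commute)
    have "?E (loop n (basis M)) = ?E (loop n (ptr (Suc m) * ?G))"
      by (simp add: M flip: basis_add_mset)
    also have "\<dots> = ?E (ptr (Suc m) * loop n ?G) + of_nat (Suc m) * ?E (ptr (n + m) * ?G)"
      by (simp only: loop_ptr_mult lin_add lin_of_nat_mult) simp
    also have "?E (ptr (Suc m) * loop n ?G) = ?E (loop m (loop n ?G))"
      by (rule IH) (use weight_loop_basis in \<open>fastforce simp: M\<close>)
    finally have 2: "?E (loop n (basis M))
        = ?E (loop m (loop n ?G)) + of_nat (Suc m) * ?E (ptr (n + m) * ?G)" .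
    have "?E (loop n (loop m ?G)) - ?E (loop m (loop n ?G))
        = ?E (of_nat m * loop (n + m - 1) ?G - of_nat n * loop (n + m - 1) ?G)"
      unfolding lin_diff[symmetric] loop_commutator by (simp only: left_diff_distrib)
    also have "\<dots> = (of_nat m - of_nat n) * ?E (loop (n + m - 1) ?G)"
      by (simp only: lin_diff lin_of_nat_mult left_diff_distrib)
    \<comment> \<open>\<open>m \<noteq> n\<close> excludes \<open>n = m = 0\<close>, so
      \<open>n + m\<close> is a successor and has a loop equation.\<close>
    also have "?E (loop (n + m - 1) ?G) = ?E (ptr (n + m) * ?G)"
    proof -
      have "Suc (n + m - 1) = n + m" using False by auto
      then show ?thesis using IH[of ?G "n + m - 1"] by (simp add: M)
    qed
    finally show ?thesis using 1 2 by (simp add: algebra_simps)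
  qed
qed

lemma gue_loop: "lin (gue \<nu>) (ptr (Suc n) * F) = lin (gue \<nu>) (loop n F)"
  unfolding lin_ptr_mult lin_loop[of _ n F] by (intro lin_cong gue_loop_basis)

lemma gue_loop_explicit:
  "gue \<nu> (add_mset (Suc n) M) =
     (\<Sum>a<n. gue \<nu> (add_mset a (add_mset (n - 1 - a) M)))
     + (\<Sum>x\<in>#M. of_nat x * gue \<nu> (add_mset (n + x - 1) (M - {#x#})))"
  by (simp only: gue_loop_basis lin_loop_basis)

text \<open>The definition brings in \<nu> only once all entries are 0. Multiplication by
  \<open>ptr 0\<close> commutes with the loop operators, since \<open>vir_deriv\<close> kills
  \<open>ptr 0\<close>, so the factor can be carried down by induction on the weight.\<close>

lemma gue_add_0: "gue \<nu> (add_mset 0 M) = \<nu> * gue \<nu> M"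
proof (induction "sum_mset M" arbitrary: M rule: less_induct)
  case less
  show ?case
  proof (cases "\<forall>x\<in>#M. x = 0")
    case True
    then show ?thesis using gue_zeros[of M \<nu>] gue_zeros[of "add_mset 0 M" \<nu>] by auto
  next
    case False
    then obtain n where "Suc n \<in># M" by (metis not0_implies_Suc)
    then obtain G where M: "M = add_mset (Suc n) G" by (metis multi_member_split)
    have "gue \<nu> (add_mset 0 M) = gue \<nu> (add_mset (Suc n) (add_mset 0 G))"
      by (simp add: M add_mset_commute)
    also have "\<dots> = lin (\<lambda>N. gue \<nu> (add_mset 0 N)) (loop n (basis G))"
    proof -
      have "(\<Sum>x\<in>#G. of_nat x * gue \<nu> (add_mset (n + x - 1) (add_mset 0 G - {#x#})))
        = (\<Sum>x\<in>#G. of_nat x * gue \<nu> (add_mset 0 (add_mset (n + x - 1) (G - {#x#}))))"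
        by (intro arg_cong[where f = sum_mset] image_mset_cong) (simp add: add_mset_commute)
      then show ?thesis
        by (simp add: gue_loop_explicit lin_loop_basis add_mset_commute[of 0])
    qed
    also have "\<dots> = lin (\<lambda>N. \<nu> * gue \<nu> N) (loop n (basis G))"
      by (intro lin_cong less) (use weight_loop_basis in \<open>fastforce simp: M\<close>)
    also have "\<dots> = \<nu> * lin (gue \<nu>) (loop n (basis G))"
      by (simp add: lin_def sum_distrib_left mult.left_commute)
    finally show ?thesis by (simp add: M gue_loop_basis)
  qed
qed

lemma lin_gue_ptr_0: "lin (gue \<nu>) (ptr 0 * F) = \<nu> * lin (gue \<nu>) F"
  unfolding lin_ptr_mult gue_add_0 by (simp add: lin_def sum_distrib_left mult.left_commute)


section \<open>The differential on words with one \<open>Xi\<close>\<close>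

abbreviation xword :: "nat \<Rightarrow> word" where
  "xword n \<equiv> replicate n X"

abbreviation xwords :: "nat list \<Rightarrow> word list" where
  "xwords \<equiv> map xword"

abbreviation mword :: "nat \<Rightarrow> nat \<Rightarrow> word" where
  "mword p q \<equiv> xword p @ Xi # xword q"

lemma ksign_0 [simp]: "ksign 0 = 1"
  by (simp add: ksign_def)

lemma wdeg_xword [simp]: "wdeg (xword n) = 0"
  by (simp add: wdeg_def sum_list_replicate)

lemma wdeg_append [simp]: "wdeg (u @ v) = wdeg u + wdeg v"
  by (simp add: wdeg_def)

lemma mdeg_xwords [simp]: "mdeg (xwords ns) = 0"
  by (induction ns) (simp_all add: mdeg_def)

lemma mword_nth: "i < p + 1 + q \<Longrightarrow> mword p q ! i = (if i = p then Xi else X)"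
  by (auto simp: nth_append nth_Cons split: nat.splits)

text \<open>Used at two levels: for the letters of a word with \<open>Xi\<close> at position
  \<open>k\<close>, where two letters \<open>X\<close> pair to 0, and for the words of a product
  whose only \<open>Xi\<close> sits in word \<open>k\<close>, where brackets of x-words
  vanish.\<close>

lemma sum_pairs_through:
  fixes T :: "nat \<Rightarrow> nat \<Rightarrow> 'a::comm_monoid_add"
  assumes "\<And>i j. i < j \<Longrightarrow> j < k + 1 + l \<Longrightarrow> i \<noteq> k \<Longrightarrow> j \<noteq> k \<Longrightarrow> T i j = 0"
  shows "(\<Sum>j<k+1+l. \<Sum>i<j. T i j) = (\<Sum>i<k. T i k) + (\<Sum>j<l. T k (k + 1 + j))"
  using assms
proof (induction l)
  case 0
  then have "(\<Sum>j<k. \<Sum>i<j. T i j) = 0"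
    by (intro sum.neutral ballI) simp
  then show ?case by simp
next
  case (Suc l)
  have "(\<Sum>i<k+1+l. T i (k + 1 + l)) = (\<Sum>i\<in>{k}. T i (k + 1 + l))"
    by (rule sum.mono_neutral_right) (auto intro!: Suc.prems)
  moreover have "(\<Sum>j<k+1+l. \<Sum>i<j. T i j) = (\<Sum>i<k. T i k) + (\<Sum>j<l. T k (k + 1 + j))"
    by (rule Suc.IH) (auto intro!: Suc.prems)
  ultimately show ?case by (simp add: add.assoc)
qed

lemma sum_through:
  fixes T :: "nat \<Rightarrow> 'a::comm_monoid_add"
  assumes "\<And>i. i < k + 1 + l \<Longrightarrow> i \<noteq> k \<Longrightarrow> T i = 0"
  shows "(\<Sum>i<k+1+l. T i) = T k"
proof -
  have "(\<Sum>i<k+1+l. T i) = (\<Sum>i\<in>{k}. T i)"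
    by (rule sum.mono_neutral_right) (auto intro!: assms)
  then show ?thesis by simp
qed

lemma word_diff_xword: "word_diff (xword n) = 0"
  by (simp add: word_diff_def)

lemma word_diff_mword: "word_diff (mword p q) = - basis (xword (p + 1 + q))"
proof -
  have "word_diff (mword p q) = (\<Sum>i<p+1+q. scale (ksign (wdeg (take i (mword p q))))
        (lin_ext (\<lambda>l. basis ((mword p q)[i := l])) (letter_diff (mword p q ! i))))"
    by (simp add: word_diff_def)
  also have "\<dots> = scale (ksign (wdeg (take p (mword p q))))
        (lin_ext (\<lambda>l. basis ((mword p q)[p := l])) (letter_diff (mword p q ! p)))"
    by (rule sum_through) (simp add: mword_nth del: One_nat_def)
  also have "\<dots> = - basis (xword (p + 1 + q))"
    by (simp add: mword_nth lin_ext_uminus list_update_append replicate_add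
        replicate_app_Cons_same)
  finally show ?thesis .
qed

lemma bracket_xword_xword: "bracket (xword m) (xword n) = 0"
  by (simp add: bracket_def Let_def)

text \<open>Each of the \<open>m\<close> letters of the second word pairs with \<open>Xi\<close> and
  leaves the same word. At \<open>p = q = m = 0\<close> the truncated exponent has coefficient
  0.\<close>

lemma bracket_mword_xword: "bracket (mword p q) (xword m) = scale (of_nat m) (basis (xword (p
    + q + m - 1)))"
proof -
  have "bracket (mword p q) (xword m) = (\<Sum>i<p+1+q. \<Sum>j<m.
        let A1 = take i (mword p q); A2 = drop (i + 1) (mword p q);
            B1 = take j (xword m); B2 = drop (j + 1) (xword m);
            x = mword p q ! i; y = xword m ! j
        in scale (ksign (wdeg A1 * (deg x + wdeg A2)
                         + wdeg B1 * (deg y + wdeg B2)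
                         + deg y * (wdeg A2 + wdeg A1))
                  * inv_pairing x y)
                 (basis (A2 @ A1 @ B2 @ B1)))" (is "_ = (\<Sum>i<p+1+q. ?T i)")
    by (simp add: bracket_def)
  also have "\<dots> = ?T p"
    by (rule sum_through) (simp add: mword_nth Let_def)
  also have "\<dots> = (\<Sum>j<m. basis (xword (p + q + m - 1)))"
    by (rule sum.cong) (auto simp: Let_def mword_nth min_def simp flip: replicate_add
        intro!: arg_cong[where f = "\<lambda>n. basis (replicate n X)"])
  finally show ?thesis
    by (simp add: free.scale_left_distrib poly_mapping_eq_iff fun_eq_iff lookup_sum)
qed

lemma bracket_xword_mword: "bracket (xword m) (mword p q) = scale (of_nat m) (basis (xword (p
    + q + m - 1)))"
proof -
  have "bracket (xword m) (mword p q) = (\<Sum>i<m. \<Sum>j<p+1+q.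
        let A1 = take i (xword m); A2 = drop (i + 1) (xword m);
            B1 = take j (mword p q); B2 = drop (j + 1) (mword p q);
            x = xword m ! i; y = mword p q ! j
        in scale (ksign (wdeg A1 * (deg x + wdeg A2)
                         + wdeg B1 * (deg y + wdeg B2)
                         + deg y * (wdeg A2 + wdeg A1))
                  * inv_pairing x y)
                 (basis (A2 @ A1 @ B2 @ B1)))" (is "_ = (\<Sum>i<m. \<Sum>j<p+1+q. ?T i j)")
    by (simp add: bracket_def)
  also have "\<dots> = (\<Sum>i<m. ?T i p)"
    by (intro sum.cong refl sum_through) (simp add: mword_nth Let_def)
  also have "\<dots> = (\<Sum>j<m. basis (xword (p + q + m - 1)))"
    by (rule sum.cong) (auto simp: Let_def mword_nth min_def simp flip: replicate_add
        intro!: arg_cong[where f = "\<lambda>n. basis (replicate n X)"])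
  finally show ?thesis
    by (simp add: free.scale_left_distrib poly_mapping_eq_iff fun_eq_iff lookup_sum)
qed

lemma cobracket_xword: "cobracket (xword n) = 0"
  by (simp add: cobracket_def Let_def)

text \<open>The first sum pairs \<open>Xi\<close> with the letters to its left, the second with
  those to its right. All Koszul signs are 1, since what remains beside the contracted
  \<open>Xi\<close> has degree 0.\<close>

lemma cobracket_mword:
  "cobracket (mword p q) = (\<Sum>a<p. basis [xword (p - 1 - a), xword (q + a)])
     + (\<Sum>b<q. basis [xword b, xword (q - 1 - b + p)])"
proof -
  have "cobracket (mword p q) = (\<Sum>j<p+1+q. \<Sum>i<j.
        let U = take i (mword p q); M = drop (i + 1) (take j (mword p q));
            V = drop (j + 1) (mword p q);
            x = mword p q ! i; y = mword p q ! j
        in scale (ksign (wdeg U * (deg x + wdeg M + deg y + wdeg V) + deg y * wdeg M)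
                  * inv_pairing x y)
                 (basis [M, V @ U]))" (is "_ = (\<Sum>j<p+1+q. \<Sum>i<j. ?T i j)")
    by (simp add: cobracket_def)
  also have "\<dots> = (\<Sum>i<p. ?T i p) + (\<Sum>j<q. ?T p (p + 1 + j))"
    by (rule sum_pairs_through) (simp add: mword_nth Let_def)
  also have "(\<Sum>i<p. ?T i p) = (\<Sum>a<p. basis [xword (p - 1 - a), xword (q + a)])"
    by (intro sum.cong) (auto simp: Let_def mword_nth min_def replicate_add)
  also have "(\<Sum>j<q. ?T p (p + 1 + j)) = (\<Sum>b<q. basis [xword b, xword (q - 1 - b + p)])"
    by (intro sum.cong) (auto simp: Let_def mword_nth min_def simp flip: replicate_add)
  finally show ?thesis .
qed

lemma d_op_mword:
  "d_op (xwords us @ mword p q # xwords vs) = - basis (xwords us @ xword (p + 1 + q) # xwords vs)"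
proof -
  let ?ws = "xwords us @ mword p q # xwords vs"
  have nth: "?ws ! i = xword ((us @ 0 # vs) ! i)" if "i < length us + 1
      + length vs" "i \<noteq> length us" for i
    using that by (auto simp: nth_append nth_Cons split: nat.splits)
  have "d_op ?ws = (\<Sum>i<length us + 1 + length vs. scale (ksign (mdeg (take i ?ws)))
        (lin_ext (\<lambda>w. basis (?ws[i := w])) (word_diff (?ws ! i))))"
    by (simp add: d_op_def)
  also have "\<dots> = scale (ksign (mdeg (take (length us) ?ws)))
        (lin_ext (\<lambda>w. basis (?ws[length us := w])) (word_diff (?ws ! length us)))"
    by (rule sum_through) (simp add: nth word_diff_xword)
  also have "\<dots> = - basis (xwords us @ xword (p + 1 + q) # xwords vs)"
    by (simp add: nth_append word_diff_mword lin_ext_uminus list_update_append)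
  finally show ?thesis .
qed

lemma nabla_op_mword:
  "nabla_op (xwords us @ mword p q # xwords vs) =
     (\<Sum>a<p. basis (xwords (us @ (p - 1 - a) # (q + a) # vs)))
     + (\<Sum>b<q. basis (xwords (us @ b # (q - 1 - b + p) # vs)))"
proof -
  let ?ws = "xwords us @ mword p q # xwords vs"
  have nth: "?ws ! i = xword ((us @ 0 # vs) ! i)" if "i < length us + 1
      + length vs" "i \<noteq> length us" for i
    using that by (auto simp: nth_append nth_Cons split: nat.splits)
  have "nabla_op ?ws = (\<Sum>i<length us + 1 + length vs. scale (ksign (mdeg (take i ?ws)))
        (lin_ext (\<lambda>vs. basis (take i ?ws @ vs @ drop (i + 1) ?ws)) (cobracket (?ws ! i))))"
    by (simp add: nabla_op_def)
  also have "\<dots> = scale (ksign (mdeg (take (length us) ?ws)))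
        (lin_ext (\<lambda>vs. basis (take (length us) ?ws @ vs @ drop (length us + 1) ?ws))
          (cobracket (?ws ! length us)))"
    by (rule sum_through) (simp add: nth cobracket_xword)
  also have "\<dots> = (\<Sum>a<p. basis (xwords (us @ (p - 1 - a) # (q + a) # vs)))
     + (\<Sum>b<q. basis (xwords (us @ b # (q - 1 - b + p) # vs)))"
    by (simp add: nth_append cobracket_mword lin_ext_add lin_ext_sum)
  finally show ?thesis .
qed

lemma delta_op_mword:
  "delta_op (xwords us @ mword p q # xwords vs) =
     (\<Sum>i<length us. scale (of_nat (us ! i))
        (basis (xwords ((p + q + us ! i - 1) # take i us @ drop (i + 1) us @ vs))))
     + (\<Sum>j<length vs. scale (of_nat (vs ! j))
        (basis (xwords ((p + q + vs ! j - 1) # us @ take j vs @ drop (j + 1) vs))))"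
proof -
  let ?ws = "xwords us @ mword p q # xwords vs"
  have nth: "?ws ! i = xword ((us @ 0 # vs) ! i)" if "i < length us + 1
      + length vs" "i \<noteq> length us" for i
    using that by (auto simp: nth_append nth_Cons split: nat.splits)
  have "delta_op ?ws = (\<Sum>j<length us + 1 + length vs. \<Sum>i<j.
        let U = take i ?ws; M = drop (i + 1) (take j ?ws); V = drop (j + 1) ?ws;
            a = ?ws ! i; b = ?ws ! j
        in scale (ksign (wdeg a * mdeg U + wdeg b * (mdeg U + mdeg M)))
             (lin_ext (\<lambda>w. basis (w # U @ M @ V)) (bracket a b)))"
      (is "_ = (\<Sum>j<_. \<Sum>i<j. ?T i j)")
    by (simp add: delta_op_def)
  also have "\<dots> = (\<Sum>i<length us. ?T i (length us))
      + (\<Sum>j<length vs. ?T (length us) (length us + 1 + j))"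
    by (rule sum_pairs_through) (simp add: Let_def nth bracket_xword_xword)
  also have "(\<Sum>i<length us. ?T i (length us)) = (\<Sum>i<length us. scale (of_nat (us ! i))
        (basis (xwords ((p + q + us ! i - 1) # take i us @ drop (i + 1) us @ vs))))"
    by (intro sum.cong) (auto simp: Let_def nth_append bracket_xword_mword lin_ext_scale
        take_map drop_map)
  also have "(\<Sum>j<length vs. ?T (length us) (length us + 1 + j))
      = (\<Sum>j<length vs. scale (of_nat (vs ! j))
        (basis (xwords ((p + q + vs ! j - 1) # us @ take j vs @ drop (j + 1) vs))))"
    by (intro sum.cong)
      (auto simp: Let_def nth_append bracket_mword_xword lin_ext_scale take_map drop_map)
  finally show ?thesis .
qed

lemma differential_basis: "differential (basis ws) = d_op ws + delta_op ws + nabla_op ws"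
  by (simp add: differential_def)


section \<open>Evaluation of chains by Gaussian correlators\<close>

definition pure :: "word list \<Rightarrow> bool" where
  "pure ws \<longleftrightarrow> (\<forall>w\<in>set ws. Xi \<notin> set w)"

definition xi_count :: "word list \<Rightarrow> nat" where
  "xi_count ws = sum_list (map (\<lambda>w. count_list w Xi) ws)"

lemma xi_count_simps [simp]:
  "xi_count [] = 0" "xi_count (w # ws) = count_list w Xi + xi_count ws"
  "xi_count (us @ vs) = xi_count us + xi_count vs"
  by (simp_all add: xi_count_def)

lemma pure_iff_xi_count: "pure ws \<longleftrightarrow> xi_count ws = 0"
  by (induction ws) (auto simp: pure_def count_list_0_iff)

lemma word_no_Xi: "Xi \<notin> set w \<Longrightarrow> w = xword (length w)"
  by (induction w) (auto, metis letter.exhaust)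

lemma pure_eq_xwords: "pure ws \<Longrightarrow> ws = xwords (map length ws)"
  by (induction ws) (auto simp: pure_def dest: word_no_Xi)

lemma pure_xwords [simp]: "pure (xwords ns)"
  by (auto simp: pure_def)

definition chain_eval :: "complex \<Rightarrow> word list \<Rightarrow> complex" where
  "chain_eval \<nu> ws = (if pure ws then gue \<nu> (mset (map length ws)) else 0)"

lemma chain_eval_xwords [simp]: "chain_eval \<nu> (xwords ns) = gue \<nu> (mset ns)"
  by (simp add: chain_eval_def comp_def)

lemma wdeg_no_Xi: "Xi \<notin> set w \<Longrightarrow> wdeg w = 0"
  by (metis word_no_Xi wdeg_xword)

text \<open>Either both terms of a relator contain \<open>Xi\<close> and evaluate to 0, or all
  letters have degree 0: then the sign is 1, and lengths and \<open>mset\<close> do not see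
  rotations and swaps.\<close>

lemma chain_eval_rel_space:
  assumes "z \<in> rel_space"
  shows "lin (chain_eval \<nu>) z = 0"
proof -
  have "rel_space \<subseteq> {z. lin (chain_eval \<nu>) z = 0}"
    unfolding rel_space_def
  proof (rule free.span_minimal)
    have "deg l = 0" if "l \<noteq> Xi" for l using that by (cases l) auto
    then have "lin (chain_eval \<nu>) (basis (us @ (l # w) # vs)
        - scale (ksign (deg l * wdeg w)) (basis (us @ (w @ [l]) # vs))) = 0" for us l w vs
      by (auto simp: lin_diff lin_scale chain_eval_def pure_def)
    moreover have "lin (chain_eval \<nu>) (basis (us @ a # b # vs)
        - scale (ksign (wdeg a * wdeg b)) (basis (us @ b # a # vs))) = 0" for us a b vs
      by (auto simp: lin_diff lin_scale chain_eval_def pure_def wdeg_no_Xi add_mset_commute)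
    ultimately show "rotation_relators \<union> swap_relators \<subseteq> {z. lin (chain_eval \<nu>) z = 0}"
      by (auto simp: rotation_relators_def swap_relators_def)
    show "free.subspace {z. lin (chain_eval \<nu>) z = 0}"
      by (auto intro!: free.subspaceI simp: lin_add lin_scale)
  qed
  with assms show ?thesis by auto
qed

lemma count_list_nth_split:
  "i < length w \<Longrightarrow> count_list w x
     = count_list (take i w) x + count_list (drop (Suc i) w) x + (if w ! i = x then 1 else 0)"
  by (subst (1) id_take_nth_drop) auto

lemma xi_count_nth_split:
  "i < length ws \<Longrightarrow> xi_count ws
     = xi_count (take i ws) + count_list (ws ! i) Xi + xi_count (drop (Suc i) ws)"
  by (subst (1) id_take_nth_drop) auto

lemma lin_word_diff:
  "lin f (word_diff a) = (\<Sum>i<length a. ksign (wdeg (take i a)) *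
     (if a ! i = Xi then - f (a[i := X]) else 0))"
proof -
  have "lin f (lin_ext (\<lambda>l. basis (a[i := l])) (letter_diff (a ! i)))
      = (if a ! i = Xi then - f (a[i := X]) else 0)" for i
    by (cases "a ! i") (simp_all add: lin_ext_uminus lin_uminus)
  then show ?thesis by (simp add: word_diff_def lin_sum lin_scale)
qed

lemma lin_word_diff_eq_0:
  assumes "\<And>b. count_list b Xi + 1 = count_list a Xi \<Longrightarrow> f b = 0"
  shows "lin f (word_diff a) = 0"
proof -
  have "f (a[i := X]) = 0" if "i < length a" "a ! i = Xi" for i
    using that count_list_nth_split[of i a Xi] by (intro assms) (simp add: upd_conv_take_nth_drop)
  then show ?thesis by (auto simp: lin_word_diff intro!: sum.neutral)
qed

lemma inv_pairing_eq_0_or: "inv_pairing x y = 0 \<or> (x = X \<and> y = Xi) \<or> (x = Xi \<and> y = X)"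
  by (cases x; cases y) auto

lemma lin_bracket_eq_0:
  assumes "\<And>c. count_list c Xi + 1 = count_list a Xi + count_list b Xi \<Longrightarrow> f c = 0"
  shows "lin f (bracket a b) = 0"
proof -
  have "inv_pairing (a ! i) (b ! j) = 0 \<or>
      f (drop (i + 1) a @ take i a @ drop (j + 1) b @ take j b) = 0"
    if "i < length a" "j < length b" for i j
    using inv_pairing_eq_0_or[of "a ! i" "b ! j"]
      count_list_nth_split[of i a Xi] count_list_nth_split[of j b Xi] that
    by (auto intro!: assms)
  then show ?thesis
    by (auto simp: bracket_def Let_def lin_sum lin_scale intro!: sum.neutral)
qed

lemma lin_cobracket_eq_0:
  assumes "\<And>vs. xi_count vs + 1 = count_list a Xi \<Longrightarrow> f vs = 0"
  shows "lin f (cobracket a) = 0"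
proof -
  have "inv_pairing (a ! i) (a ! j) = 0 \<or>
      f [drop (i + 1) (take j a), drop (j + 1) a @ take i a] = 0"
    if "j < length a" "i < j" for i j
    using inv_pairing_eq_0_or[of "a ! i" "a ! j"] count_list_nth_split[of j a Xi]
      count_list_nth_split[of i "take j a" Xi] that
    by (auto intro!: assms simp: min_def)
  then show ?thesis
    by (auto simp: cobracket_def Let_def lin_sum lin_scale intro!: sum.neutral)
qed

text \<open>Each of the three operators removes exactly one \<open>Xi\<close>, so only products with
  a single \<open>Xi\<close> can have terms without \<open>Xi\<close> in their boundary.\<close>

lemma chain_eval_differential_impure:
  assumes "xi_count ws \<noteq> 1"
  shows "lin (chain_eval \<nu>) (differential (basis ws)) = 0"
proof -
  have impure: "chain_eval \<nu> vs = 0" if "xi_count vs + 1 = xi_count ws" for vs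
    using that assms by (simp add: chain_eval_def pure_iff_xi_count)
  have "lin (\<lambda>w. chain_eval \<nu> (ws[i := w])) (word_diff (ws ! i)) = 0" if "i < length ws" for i
    using xi_count_nth_split[OF that] that
    by (intro lin_word_diff_eq_0 impure) (simp add: upd_conv_take_nth_drop)
  then have "lin (chain_eval \<nu>) (d_op ws) = 0"
    by (auto simp: d_op_def lin_sum lin_scale lin_lin_ext intro!: sum.neutral)
  moreover have "lin (\<lambda>vs. chain_eval \<nu> (take i ws @ vs @ drop (i + 1) ws)) (cobracket (ws ! i))
      = 0"
    if "i < length ws" for i
    using xi_count_nth_split[OF that] by (intro lin_cobracket_eq_0 impure) simp
  then have "lin (chain_eval \<nu>) (nabla_op ws) = 0"
    by (auto simp: nabla_op_def lin_sum lin_scale lin_lin_ext intro!: sum.neutral)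
  moreover have "lin (\<lambda>w. chain_eval \<nu> (w # take i ws @ drop (i + 1) (take j ws) @ drop (j
      + 1) ws))
      (bracket (ws ! i) (ws ! j)) = 0" if "j < length ws" "i < j" for i j
    using xi_count_nth_split[of j ws] xi_count_nth_split[of i "take j ws"] that
    by (intro lin_bracket_eq_0 impure) (simp add: min_def)
  then have "lin (chain_eval \<nu>) (delta_op ws) = 0"
    by (auto simp: delta_op_def Let_def lin_sum lin_scale lin_lin_ext intro!: sum.neutral)
  ultimately show ?thesis by (simp add: differential_basis lin_add)
qed

lemma sum_mset_remove_union:
  "(\<Sum>x\<in>#M. f x (M - {#x#} + N)) + (\<Sum>x\<in>#N. f x (M + (N - {#x#}))) = (\<Sum>x\<in>#M + N. f x (M + N
      - {#x#}))"
proof -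
  have "image_mset (\<lambda>x. f x (M - {#x#} + N)) M = image_mset (\<lambda>x. f x (M + N - {#x#})) M"
    by (rule image_mset_cong) simp
  moreover have "image_mset (\<lambda>x. f x (M + (N - {#x#}))) N = image_mset (\<lambda>x. f x (M + N
      - {#x#})) N"
    by (rule image_mset_cong) (simp only: diff_union_single_conv)
  ultimately show ?thesis by (simp only: image_mset_union sum_mset.union)
qed

lemma sum_mset_mset_conv_nth:
  "(\<Sum>x\<in>#mset xs. f x (mset xs - {#x#})) = (\<Sum>i<length xs. f (xs ! i) (mset (take i xs @ drop (i
      + 1) xs)))"
proof -
  have "mset xs - {#xs ! i#} = mset (take i xs @ drop (i + 1) xs)" if "i < length xs" for i
    by (subst id_take_nth_drop[OF that]) simp
  moreover have "(\<Sum>x\<in>#mset xs. f x (mset xs - {#x#})) = (\<Sum>i<length xs. f (xs ! i) (mset xs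
      - {#xs ! i#}))"
    by (simp add: sum_mset_sum_list sum_list_sum_nth atLeast0LessThan flip: mset_map)
  ultimately show ?thesis by simp
qed

text \<open>This is the loop equation: \<open>d_op\<close> yields minus the trace of index
  \<open>p + q + 1\<close>, \<open>nabla_op\<close> the split terms and \<open>delta_op\<close> the
  joined ones.\<close>

lemma chain_eval_differential_mword:
  "lin (chain_eval \<nu>) (differential (basis (xwords us @ mword p q # xwords vs))) = 0"
proof -
  define M where "M = mset us + mset vs"
  have d: "lin (chain_eval \<nu>) (d_op (xwords us @ mword p q # xwords vs))
      = - gue \<nu> (add_mset (Suc (p + q)) M)"
    using chain_eval_xwords[of \<nu> "us @ (p + 1 + q) # vs"]
    by (simp add: d_op_mword lin_uminus M_def del: chain_eval_xwords replicate_Suc)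
  have "(\<Sum>a<p. gue \<nu> (add_mset (p - 1 - a) (add_mset (q + a) M)))
      = (\<Sum>a<p. gue \<nu> (add_mset a (add_mset (p + q - 1 - a) M)))"
    by (rule sum.reindex_bij_witness[of _ "\<lambda>a. p - 1 - a" "\<lambda>a. p - 1 - a"]) auto
  \<comment> \<open>The letters to the right of \<open>Xi\<close> supply the upper part of the range
    of \<open>a\<close>; together the two sums form one split sum.\<close>
  moreover have "(\<Sum>b<q. gue \<nu> (add_mset b (add_mset (q - 1 - b + p) M)))
      = (\<Sum>a=p..<p+q. gue \<nu> (add_mset a (add_mset (p + q - 1 - a) M)))"
    by (rule sum.reindex_bij_witness[of _ "\<lambda>a. p + q - 1 - a" "\<lambda>b. p + q - 1 - b"])
      (auto simp: add_mset_commute add.commute[of q])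
  moreover have "(\<Sum>a<p+q. g a) = (\<Sum>a<p. g a) + (\<Sum>a=p..<p+q. g a)" for g :: "nat \<Rightarrow> complex"
    by (metis atLeast0LessThan sum.atLeastLessThan_concat le_add1 zero_le)
  ultimately have nabla: "lin (chain_eval \<nu>) (nabla_op (xwords us @ mword p q # xwords vs))
      = (\<Sum>a<p+q. gue \<nu> (add_mset a (add_mset (p + q - 1 - a) M)))"
    unfolding nabla_op_mword lin_add lin_sum lin_basis chain_eval_xwords
    by (simp add: M_def)
  have "lin (chain_eval \<nu>) (delta_op (xwords us @ mword p q # xwords vs))
      = (\<Sum>i<length us. of_nat (us ! i) * gue \<nu> (add_mset (p + q + us ! i - 1)
          (mset (take i us @ drop (i + 1) us) + mset vs)))
        + (\<Sum>j<length vs. of_nat (vs ! j) * gue \<nu> (add_mset (p + q + vs ! j - 1)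
          (mset us + mset (take j vs @ drop (j + 1) vs))))"
    unfolding delta_op_mword lin_add lin_sum lin_scale lin_basis chain_eval_xwords
    by (simp add: add.assoc)
  also have "\<dots> = (\<Sum>x\<in>#mset us. of_nat x * gue \<nu> (add_mset (p + q + x - 1)
          (mset us - {#x#} + mset vs)))
        + (\<Sum>x\<in>#mset vs. of_nat x * gue \<nu> (add_mset (p + q + x - 1)
          (mset us + (mset vs - {#x#}))))"
    using sum_mset_mset_conv_nth[of "\<lambda>x N. of_nat x * gue \<nu> (add_mset (p + q + x - 1) (N
        + mset vs))" us]
      sum_mset_mset_conv_nth[of "\<lambda>x N. of_nat x * gue \<nu> (add_mset (p + q + x - 1) (mset us
          + N))" vs]
    by simp
  also have "\<dots> = (\<Sum>x\<in>#M. of_nat x * gue \<nu> (add_mset (p + q + x - 1) (M - {#x#})))"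
    unfolding M_def
    by (rule sum_mset_remove_union[of "\<lambda>x N. of_nat x * gue \<nu> (add_mset (p + q + x - 1) N)"])
  finally show ?thesis
    by (simp add: differential_basis lin_add d nabla gue_loop_explicit)
qed

lemma count_list_Xi_1:
  assumes "count_list w Xi = 1"
  obtains p q where "w = mword p q"
proof -
  obtain u v where "w = u @ Xi # v" "Xi \<notin> set u" "Xi \<notin> set v"
    using assms split_list_first[of Xi w] by (force simp: count_list_0_iff)
  then show thesis using that[of "length u" "length v"] word_no_Xi by metis
qed

lemma xi_count_1:
  assumes "xi_count ws = 1"
  obtains us p q vs where "ws = xwords us @ mword p q # xwords vs"
proof -
  from assms have "\<exists>us p q vs. ws = xwords us @ mword p q # xwords vs"
  proof (induction ws)
    case (Cons w ws)
    show ?case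
    proof (cases "count_list w Xi = 0")
      case True
      then obtain us p q vs where "ws = xwords us @ mword p q # xwords vs" using Cons by auto
      moreover have "w = xword (length w)"
          using True by (intro word_no_Xi) (simp add: count_list_0_iff)
      ultimately have "w # ws = xwords (length w # us) @ mword p q # xwords vs" by simp
      then show ?thesis by blast
    next
      case False
      then have "count_list w Xi = 1" "pure ws" using Cons.prems by (auto simp: pure_iff_xi_count)
      then have "w # ws = xwords [] @ w # xwords (map length ws)"
        using pure_eq_xwords by (metis append_Nil list.simps(8))
      then show ?thesis using count_list_Xi_1[OF \<open>count_list w Xi = 1\<close>] by metis
    qed
  qed simp
  then show thesis using that by blast
qed

lemma chain_eval_differential: "lin (chain_eval \<nu>) (differential y) = 0"
proof -
  have "lin (chain_eval \<nu>) (differential (basis ws)) = 0" for ws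
  proof (cases "xi_count ws = 1")
    case True
    then show ?thesis by (metis xi_count_1 chain_eval_differential_mword)
  next
    case False
    then show ?thesis by (rule chain_eval_differential_impure)
  qed
  then show ?thesis
    by (simp add: differential_def lin_lin_ext) (simp add: lin_def)
qed

lemma chain_eval_cohomologous:
  assumes "cohomologous z z'"
  shows "lin (chain_eval \<nu>) z = lin (chain_eval \<nu>) z'"
proof -
  obtain y where "z - z' - differential y \<in> rel_space"
    using assms by (auto simp: cohomologous_def)
  then show ?thesis
    using chain_eval_rel_space[of _ \<nu>] chain_eval_differential[of \<nu> y] by (force simp: lin_diff)
qed

lemma chain_eval_nu_poly: "lin (chain_eval \<nu>) (nu_poly p) = poly p \<nu>"
proof -
  have "chain_eval \<nu> (replicate m []) = \<nu> ^ m" for m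
  proof -
    have "gue \<nu> (replicate_mset m 0) = \<nu> ^ m"
      by (subst gue_zeros) (auto simp: in_replicate_mset split: if_splits)
    then show ?thesis by (simp add: chain_eval_def pure_def)
  qed
  then show ?thesis
    by (simp add: nu_poly_def lin_sum lin_scale poly_altdef)
qed

text \<open>Since \<nu> is an arbitrary complex number here, this determines \<open>p\<close> by its
  values.\<close>

lemma represents_imp_poly:
  assumes "represents p i"
  shows "poly p \<nu> = gue \<nu> {#i#}"
  using chain_eval_cohomologous[OF assms[unfolded represents_def], of \<nu>]
    chain_eval_xwords[of \<nu> "[i]"]
  by (simp add: chain_eval_nu_poly x_power_def)

lemma represents_unique:
  assumes "represents p i" "represents q i"
  shows "p = q"
  using represents_imp_poly[OF assms(1)] represents_imp_poly[OF assms(2)]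
  by (simp add: poly_eq_poly_eq_iff[symmetric] fun_eq_iff)

section \<open>Reduction to polynomials in \<open>\<nu>\<close>\<close>

lemma nu_poly_eq: "degree p \<le> n \<Longrightarrow> nu_poly p = (\<Sum>m\<le>n. scale (coeff p m) (basis (replicate m [])))"
  unfolding nu_poly_def by (intro sum.mono_neutral_left) (auto simp: coeff_eq_0)

lemma nu_poly_add: "nu_poly (p + q) = nu_poly p + nu_poly q"
proof -
  let ?n = "max (degree p) (degree q)"
  show ?thesis
    by (simp add: nu_poly_eq[of _ ?n] degree_add_le_max free.scale_left_distrib sum.distrib)
qed

lemma nu_poly_smult: "nu_poly (smult c p) = scale c (nu_poly p)"
  by (simp add: nu_poly_eq[of _ "degree p"] degree_smult_le free.scale_sum_right)

lemma nu_poly_monom: "nu_poly (monom 1 r) = basis (replicate r [])"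
proof -
  have "nu_poly (monom 1 r) = (\<Sum>m\<le>r. scale (if m = r then 1 else 0) (basis (replicate m [])))"
    by (subst nu_poly_eq[of _ r]) (auto simp: degree_monom_le intro!: sum.cong)
  also have "\<dots> = (\<Sum>m\<in>{r}. scale 1 (basis (replicate m [])))"
    by (rule sum.mono_neutral_cong_right) auto
  finally show ?thesis by simp
qed

lemma differential_add: "differential (x + y) = differential x + differential y"
  by (simp add: differential_def lin_ext_add)

lemma differential_scale: "differential (scale c x) = scale c (differential x)"
  by (simp add: differential_def lin_ext_scale)

definition reducible :: "chain set" where
  "reducible = {z. \<exists>p y. z = nu_poly p + differential y}"

lemma reducible_add: "z \<in> reducible \<Longrightarrow> z' \<in> reducible \<Longrightarrow> z + z' \<in> reducible"
proof -
  assume "z \<in> reducible" "z' \<in> reducible"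
  then obtain p y p' y' where "z = nu_poly p + differential y" "z' = nu_poly p' + differential y'"
    by (auto simp: reducible_def)
  then have "z + z' = nu_poly (p + p') + differential (y + y')"
    by (simp add: nu_poly_add differential_add)
  then show ?thesis by (auto simp: reducible_def)
qed

lemma reducible_scale: "z \<in> reducible \<Longrightarrow> scale c z \<in> reducible"
proof -
  assume "z \<in> reducible"
  then obtain p y where "z = nu_poly p + differential y" by (auto simp: reducible_def)
  then have "scale c z = nu_poly (smult c p) + differential (scale c y)"
    by (simp add: nu_poly_smult differential_scale free.scale_right_distrib)
  then show ?thesis by (auto simp: reducible_def)
qed

lemma reducible_zero: "0 \<in> reducible"
proof -
  have "(0 :: chain) = nu_poly 0 + differential 0"
    by (simp add: nu_poly_def differential_def)
  then show ?thesis by (auto simp: reducible_def)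
qed

lemma reducible_sum: "(\<And>i. i \<in> S \<Longrightarrow> f i \<in> reducible) \<Longrightarrow> sum f S \<in> reducible"
  by (induction S rule: infinite_finite_induct) (auto simp: reducible_zero reducible_add)

lemma sum_list_nth_split:
  "i < length xs \<Longrightarrow> sum_list xs = sum_list (take i xs) + xs ! i + sum_list (drop (i + 1) xs)"
  for xs :: "nat list"
  by (subst (1) id_take_nth_drop) auto

lemma xwords_reducible: "basis (xwords ns) \<in> reducible"
proof (induction "sum_list ns" arbitrary: ns rule: less_induct)
  case less
  show ?case
  proof (cases "\<forall>n\<in>set ns. n = 0")
    case True
    then have "xwords ns = replicate (length ns) []"
      by (induction ns) auto
    then have "basis (xwords ns) = nu_poly (monom 1 (length ns)) + differential 0"
      by (simp add: nu_poly_monom differential_def)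
    then show ?thesis unfolding reducible_def by blast
  next
    case False
    then obtain n where "n \<in> set ns" "n \<noteq> 0" by auto
    then obtain us vs q where ns: "ns = us @ Suc q # vs"
      by (metis not0_implies_Suc split_list)
    \<comment> \<open>Trading one letter of a nonempty word for \<open>Xi\<close> gives a product
      whose boundary is minus the given one plus products of smaller total length.\<close>
    let ?w = "xwords us @ mword 0 q # xwords vs"
    have "basis (xwords ns) = delta_op ?w + nabla_op ?w - differential (basis ?w)"
      by (simp add: differential_basis ns d_op_mword[of us 0 q vs, simplified])
    moreover have "delta_op ?w \<in> reducible"
      unfolding delta_op_mword
      by (intro reducible_add reducible_sum reducible_scale less)
        (use sum_list_nth_split in \<open>fastforce simp: ns\<close>)+
    moreover have "nabla_op ?w \<in> reducible"
      unfolding nabla_op_mword by (intro reducible_add reducible_sum less) (auto simp: ns)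
    moreover have "scale (-1) (differential (basis ?w)) \<in> reducible"
    proof (rule reducible_scale)
      have "differential (basis ?w) = nu_poly 0 + differential (basis ?w)"
        by (simp add: nu_poly_def)
      then show "differential (basis ?w) \<in> reducible" unfolding reducible_def by blast
    qed
    ultimately show ?thesis
      using reducible_add[of "delta_op ?w + nabla_op ?w" "scale (-1) (differential (basis ?w))"]
      by (auto intro: reducible_add)
  qed
qed

lemma represents_exists: "\<exists>p. represents p i"
proof -
  obtain p y where "basis (xwords [i]) = nu_poly p + differential y"
    using xwords_reducible[of "[i]"] by (auto simp: reducible_def)
  then have "x_power i - nu_poly p - differential y = 0"
    by (simp add: x_power_def)
  then show ?thesis
    unfolding represents_def cohomologous_def rel_space_def by (metis free.span_zero)
qed

lemma represents_ex1: "\<exists>!p. represents p i"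
  using represents_exists represents_unique by blast

lemma poly_hz_poly: "poly (hz_poly i) \<nu> = gue \<nu> {#i#}"
  unfolding hz_poly_def by (rule represents_imp_poly) (rule theI'[OF represents_ex1])


section \<open>Correlators of complete and elementary symmetric functions\<close>

text \<open>Newton's recursion: \<open>sym_gen 1 n = h\<^sub>n\<close> and \<open>sym_gen (-1) n = (-1)\<^sup>n e\<^sub>n\<close>.\<close>

fun sym_gen :: "complex \<Rightarrow> nat \<Rightarrow> trace_ring" where
  "sym_gen c 0 = 1"
| "sym_gen c (Suc n) = const (c / of_nat (Suc n)) * (\<Sum>k\<le>n. ptr (Suc k) * sym_gen c (n - k))"

declare sym_gen.simps(2) [simp del]

lemma const_mult_const: "const a * const b = const (a * b)"
  by (simp add: mult_single)

lemma of_nat_Suc_mult_const: "of_nat (Suc n) * const (c / of_nat (Suc n)) = const c"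
proof -
  have "of_nat (Suc n) * const (c / of_nat (Suc n))
      = const (of_nat (Suc n)) * const (c / of_nat (Suc n))"
    by (simp only: single_of_nat)
  also have "\<dots> = const c"
    by (simp only: const_mult_const) (simp del: of_nat_Suc)
  finally show ?thesis .
qed

lemma sym_gen_Suc:
  "of_nat (Suc n) * sym_gen c (Suc n) = const c * (\<Sum>k\<le>n. ptr (Suc k) * sym_gen c (n - k))"
  by (simp only: sym_gen.simps mult.assoc[symmetric] of_nat_Suc_mult_const)

lemma of_nat_Suc_mult_eq_0:
  fixes F :: trace_ring
  assumes "of_nat (Suc n) * F = 0"
  shows "F = 0"
proof -
  have "F = const 1 * F" by simp
  also have "\<dots> = of_nat (Suc n) * const (1 / of_nat (Suc n)) * F"
    by (simp only: of_nat_Suc_mult_const)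
  also have "\<dots> = const (1 / of_nat (Suc n)) * (of_nat (Suc n) * F)"
    by (simp only: mult_ac)
  finally show ?thesis using assms by simp
qed

section \<open>Generating functions, compared through linear differential equations\<close>

definition sym_fps :: "complex \<Rightarrow> trace_ring fps" where
  "sym_fps c = Abs_fps (sym_gen c)"

definition ptr_fps :: "nat \<Rightarrow> trace_ring fps" where
  "ptr_fps n = Abs_fps (\<lambda>k. ptr (n + k))"

lemma sym_fps_nth [simp]: "fps_nth (sym_fps c) n = sym_gen c n"
  by (simp add: sym_fps_def)

lemma ptr_fps_nth [simp]: "fps_nth (ptr_fps n) k = ptr (n + k)"
  by (simp add: ptr_fps_def)

text \<open>Newton's recursion as a differential equation: \<open>sym_fps c\<close> is the
  exponential of \<open>c\<close> times the sum of \<open>p_k t^k / k\<close>.\<close>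

lemma fps_deriv_sym_fps: "fps_deriv (sym_fps c) = fps_const (const c) * ptr_fps 1 * sym_fps c"
proof (rule fps_ext)
  fix n
  show "fps_nth (fps_deriv (sym_fps c)) n
      = fps_nth (fps_const (const c) * ptr_fps 1 * sym_fps c) n"
    using sym_gen_Suc[of n c]
    by (simp only: mult.assoc fps_mult_left_const_nth fps_deriv_nth)
      (simp add: fps_mult_nth atLeast0AtMost)
qed

text \<open>The equation determines the coefficients recursively, as positive integers can be
  cancelled. Identities of series are proved below by showing that the difference of the two sides
  is such a \<open>Z\<close>.\<close>

lemma fps_ode_unique:
  fixes Z :: "trace_ring fps"
  assumes "fps_deriv Z = A * Z" "fps_nth Z 0 = 0"
  shows "Z = 0"
proof (rule fps_ext)
  fix n
  show "fps_nth Z n = fps_nth 0 n"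
  proof (induction n rule: less_induct)
    case (less n)
    show ?case
    proof (cases n)
      case 0
      then show ?thesis using assms by simp
    next
      case (Suc k)
      have "of_nat (Suc k) * fps_nth Z (Suc k) = fps_nth (A * Z) k"
        using assms(1) by (metis fps_deriv_nth Suc_eq_plus1)
      also have "\<dots> = 0"
        unfolding fps_mult_nth using less Suc by (intro sum.neutral) auto
      finally show ?thesis using Suc of_nat_Suc_mult_eq_0 by auto
    qed
  qed
qed

lemma sym_fps_inverse: "sym_fps c * sym_fps (- c) = 1"
proof -
  have "fps_deriv (sym_fps c * sym_fps (- c) - 1) = 0 * (sym_fps c * sym_fps (- c) - 1)"
    by (simp add: fps_deriv_sym_fps single_uminus algebra_simps flip: fps_const_neg)
  then have "sym_fps c * sym_fps (- c) - 1 = 0"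
    by (rule fps_ode_unique) simp
  then show ?thesis by simp
qed

lemma ptr_conv_sym_gen: "ptr (Suc m)
    = (\<Sum>i\<le>m. of_nat (Suc i) * (sym_gen 1 (Suc i) * sym_gen (-1) (m - i)))"
proof -
  have "fps_deriv (sym_fps 1) * sym_fps (-1) = ptr_fps 1"
    using sym_fps_inverse[of 1] by (simp add: fps_deriv_sym_fps mult.assoc)
  then have "ptr (Suc m) = fps_nth (fps_deriv (sym_fps 1) * sym_fps (-1)) m" by simp
  then show ?thesis
    by (simp add: fps_mult_nth atLeast0AtMost mult.assoc)
qed

definition vir_fps :: "nat \<Rightarrow> trace_ring fps \<Rightarrow> trace_ring fps" where
  "vir_fps n A = Abs_fps (\<lambda>k. vir_deriv n (fps_nth A k))"

lemma vir_fps_mult: "vir_fps n (A * B) = vir_fps n A * B + A * vir_fps n B"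
  by (rule fps_ext) (simp add: vir_fps_def fps_mult_nth vir_deriv_sum vir_deriv_mult sum.distrib)

lemma vir_fps_deriv: "vir_fps n (fps_deriv A) = fps_deriv (vir_fps n A)"
  by (rule fps_ext) (simp add: vir_fps_def vir_deriv_of_nat_mult del: of_nat_Suc of_nat_add)

lemma vir_fps_const: "vir_fps n (fps_const (const c) * A) = fps_const (const c) * vir_fps n A"
  by (rule fps_ext) (simp add: vir_fps_def vir_deriv_const_mult)

lemma vir_fps_ptr_fps: "vir_fps n (ptr_fps 1) = fps_deriv (fps_X * ptr_fps n)"
  by (rule fps_ext) (auto simp: vir_fps_def vir_deriv_ptr algebra_simps)

text \<open>Applying the derivation to \<open>H' = c P H\<close> gives an inhomogeneous linear
  equation for the image of \<open>H\<close>, with the source term of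
  \<open>vir_fps_ptr_fps\<close>. The right-hand side solves it too and also has constant term
  0.\<close>

lemma vir_fps_sym_fps: "vir_fps n (sym_fps c)
    = fps_const (const c) * (fps_X * ptr_fps n) * sym_fps c"
proof -
  let ?Y = "fps_const (const c) * (fps_X * ptr_fps n) * sym_fps c"
  let ?A = "fps_const (const c) * ptr_fps 1"
  have "fps_deriv (vir_fps n (sym_fps c))
      = fps_const (const c) * vir_fps n (ptr_fps 1 * sym_fps c)"
    by (simp only: vir_fps_deriv[symmetric] fps_deriv_sym_fps mult.assoc vir_fps_const)
  then have "fps_deriv (vir_fps n (sym_fps c))
      = fps_const (const c) * (fps_deriv (fps_X * ptr_fps n) * sym_fps c
          + ptr_fps 1 * vir_fps n (sym_fps c))"
    by (simp only: vir_fps_mult vir_fps_ptr_fps)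
  moreover have "fps_deriv ?Y
      = fps_const (const c) * (fps_deriv (fps_X * ptr_fps n) * sym_fps c + ptr_fps 1 * ?Y)"
    unfolding mult.assoc[of "fps_const (const c)"] fps_deriv_mult_const_left fps_deriv_mult[of
        "fps_X * ptr_fps n"]
      fps_deriv_sym_fps by (simp add: algebra_simps)
  ultimately have "fps_deriv (vir_fps n (sym_fps c) - ?Y) = ?A * (vir_fps n (sym_fps c) - ?Y)"
    by (simp only: fps_deriv_sub) (simp add: algebra_simps)
  then have "vir_fps n (sym_fps c) - ?Y = 0"
    by (rule fps_ode_unique) (simp add: vir_fps_def)
  then show ?thesis by simp
qed

lemma vir_deriv_sym_gen:
  "vir_deriv n (sym_gen c i) = const c * (\<Sum>k<i. ptr (n + k) * sym_gen c (i - 1 - k))"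
proof -
  have "vir_deriv n (sym_gen c i) = fps_nth (vir_fps n (sym_fps c)) i"
    by (simp add: vir_fps_def)
  also have "\<dots> = fps_nth (fps_const (const c) * (fps_X * (ptr_fps n * sym_fps c))) i"
    unfolding vir_fps_sym_fps by (simp only: mult.assoc)
  also have "\<dots> = const c * (\<Sum>k<i. ptr (n + k) * sym_gen c (i - 1 - k))"
  proof (cases i)
    case (Suc j)
    then show ?thesis
      by (simp add: fps_mult_nth[of "ptr_fps n"] atLeast0AtMost lessThan_Suc_atMost)
  qed simp
  finally show ?thesis .
qed

lemma ptr_fps_0: "ptr_fps 0 = fps_const (ptr 0) + fps_X * ptr_fps 1"
  by (rule fps_ext) (simp add: fps_X_mult_nth)

text \<open>Newton's identity, where 1 / c equals c, together with the term \<open>k = 0\<close>,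
  which contributes the matrix size.\<close>

lemma sum_ptr_sym_gen:
  assumes "c * c = 1"
  shows "(\<Sum>k\<le>i. ptr k * sym_gen c (i - k)) = (ptr 0 + const c * of_nat i) * sym_gen c i"
proof -
  have cc: "fps_const (const c) * fps_const (const c) = 1"
    using assms by (simp add: mult_single)
  have "fps_const (const c) * fps_deriv (sym_fps c)
      = (fps_const (const c) * fps_const (const c)) * (ptr_fps 1 * sym_fps c)"
    unfolding fps_deriv_sym_fps by (simp only: mult.assoc)
  then have 1: "ptr_fps 0 * sym_fps c
      = fps_const (ptr 0) * sym_fps c + fps_const (const c) * (fps_X * fps_deriv (sym_fps c))"
    unfolding cc by (simp add: ptr_fps_0 algebra_simps)
  have "(\<Sum>k\<le>i. ptr k * sym_gen c (i - k)) = fps_nth (ptr_fps 0 * sym_fps c) i"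
    by (simp add: fps_mult_nth atLeast0AtMost)
  also have "\<dots> = ptr 0 * sym_gen c i + const c * (of_nat i * sym_gen c i)"
    unfolding 1 by (cases i) simp_all
  finally show ?thesis by (simp add: algebra_simps)
qed

lemma sum_vir_deriv_sym_gen:
  "(\<Sum>n\<le>Suc K. vir_deriv n (sym_gen c (Suc K - n)))
     = const c * (\<Sum>l\<le>K. of_nat (Suc l) * (ptr l * sym_gen c (K - l)))"
proof -
  have "(\<Sum>n\<le>Suc K. vir_deriv n (sym_gen c (Suc K - n)))
      = (\<Sum>n\<le>K. const c * (\<Sum>k\<le>K - n. ptr (n + k) * sym_gen c (K - (n + k))))"
    by (simp add: vir_deriv_sym_gen Suc_diff_le lessThan_Suc_atMost cong: sum.cong_simp)
  also have "\<dots> = const c * (\<Sum>(n,k)\<in>{(n, k). n + k \<le> K}. ptr (n + k) * sym_gen c (K - (n + k)))"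
    unfolding sum_distrib_left[symmetric]
    by (subst sum.Sigma) (auto intro!: arg_cong[where f = "\<lambda>x. const c * x"] sum.cong)
  \<comment> \<open>Each \<open>ptr l\<close> is reached from the \<open>l + 1\<close> pairs with
    \<open>n + k = l\<close>; this is the origin of the factor \<open>Suc l\<close>.\<close>
  also have "\<dots> = const c * (\<Sum>l\<le>K. \<Sum>n\<le>l. ptr (n + (l - n)) * sym_gen c (K - (n + (l - n))))"
    by (simp only: sum.triangle_reindex_eq)
  also have "(\<Sum>l\<le>K. \<Sum>n\<le>l. ptr (n + (l - n)) * sym_gen c (K - (n + (l - n))))
      = (\<Sum>l\<le>K. of_nat (Suc l) * (ptr l * sym_gen c (K - l)))"
    by (intro sum.cong) (simp_all del: of_nat_Suc)
  finally show ?thesis .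
qed

text \<open>The split sums have the generating function \<open>t\<close> times the square of
  \<open>ptr_fps 0\<close>.\<close>

lemma sum_split_sum_sym_gen:
  "(\<Sum>n\<le>Suc K. split_sum n * sym_gen c (Suc K - n))
     = (\<Sum>a\<le>K. ptr a * (\<Sum>b\<le>K - a. ptr b * sym_gen c (K - a - b)))"
proof -
  have "Abs_fps split_sum = fps_X * (ptr_fps 0 * ptr_fps 0)"
  proof (rule fps_ext)
    fix n
    show "fps_nth (Abs_fps split_sum) n = fps_nth (fps_X * (ptr_fps 0 * ptr_fps 0)) n"
      by (cases n) (simp_all add: split_sum_def fps_mult_nth[of "ptr_fps 0"] atLeast0AtMost
          lessThan_Suc_atMost)
  qed
  then have "Abs_fps split_sum * sym_fps c = fps_X * (ptr_fps 0 * (ptr_fps 0 * sym_fps c))"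
    by (simp add: mult.assoc)
  then have "fps_nth (Abs_fps split_sum * sym_fps c) (Suc K)
      = fps_nth (ptr_fps 0 * (ptr_fps 0 * sym_fps c)) K"
    by simp
  then show ?thesis by (simp add: fps_mult_nth atLeast0AtMost)
qed

text \<open>Newton's identity for the inner sum leaves the coefficient
  \<open>ptr 0 + c (K - a)\<close>, and the derivative adds \<open>c (a + 1)\<close>. The total does
  not depend on \<open>a\<close>, so the identity applies a second time to the outer sum.\<close>

lemma loop_sum_sym_gen:
  assumes "c * c = 1"
  shows "(\<Sum>n\<le>Suc K. split_sum n * sym_gen c (Suc K - n) + vir_deriv n (sym_gen c (Suc K - n)))
     = (ptr 0 + const c * of_nat (Suc K)) * ((ptr 0 + const c * of_nat K) * sym_gen c K)"
proof -
  have "(\<Sum>n\<le>Suc K. split_sum n * sym_gen c (Suc K - n) + vir_deriv n (sym_gen c (Suc K - n)))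
      = (\<Sum>a\<le>K. ptr a * ((ptr 0 + const c * of_nat (K - a)) * sym_gen c (K - a)))
        + const c * (\<Sum>l\<le>K. of_nat (Suc l) * (ptr l * sym_gen c (K - l)))"
    unfolding sum.distrib sum_split_sum_sym_gen sum_vir_deriv_sym_gen sum_ptr_sym_gen[OF assms] ..
  also have "\<dots> = (\<Sum>a\<le>K. (ptr 0 + const c * of_nat (Suc K)) * (ptr a * sym_gen c (K - a)))"
    unfolding sum_distrib_left sum.distrib[symmetric]
    by (intro sum.cong) (simp_all add: of_nat_diff algebra_simps)
  finally show ?thesis
    by (simp only: sum_distrib_left[symmetric] sum_ptr_sym_gen[OF assms])
qed

text \<open>Up to the factor \<open>- c\<close>, the terms in which the derivation of the loop
  equation hits the second factor.\<close>

definition mix_sum :: "complex \<Rightarrow> nat \<Rightarrow> nat \<Rightarrow> trace_ring" where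
  "mix_sum c K j = (\<Sum>n\<le>K. sym_gen c (K - n) * (\<Sum>k<j. ptr (n + k) * sym_gen (- c) (j - 1 - k)))"

text \<open>Shifting \<open>k\<close> in the first sum and \<open>n\<close> in the second makes the
  bulk coincide. What is left are the terms with \<open>k = 0\<close> and those with
  \<open>n = 0\<close>, and \<open>sum_ptr_sym_gen\<close> evaluates both.\<close>

lemma mix_sum_diff:
  "mix_sum c K (Suc j) - mix_sum c (Suc K) j
     = (\<Sum>n\<le>K. ptr n * sym_gen c (K - n)) * sym_gen (- c) j
       - sym_gen c (Suc K) * (\<Sum>k<j. ptr k * sym_gen (- c) (j - 1 - k))"
proof -
  have "mix_sum c K (Suc j) = (\<Sum>n\<le>K. ptr n * sym_gen c (K - n)) * sym_gen (- c) j
      + (\<Sum>n\<le>K. sym_gen c (K - n) * (\<Sum>k<j. ptr (Suc n + k) * sym_gen (- c) (j - 1 - k)))"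
    unfolding mix_sum_def sum_distrib_right sum.distrib[symmetric]
    by (intro sum.cong) (simp_all add: sum.lessThan_Suc_shift algebra_simps del: sum.lessThan_Suc)
  moreover have "mix_sum c (Suc K) j = sym_gen c (Suc K) * (\<Sum>k<j. ptr k * sym_gen (- c) (j - 1
      - k))
      + (\<Sum>n\<le>K. sym_gen c (K - n) * (\<Sum>k<j. ptr (Suc n + k) * sym_gen (- c) (j - 1 - k)))"
    unfolding mix_sum_def by (subst sum.atMost_Suc_shift) simp
  ultimately show ?thesis by simp
qed

section \<open>Recurrences for the correlators of products of h and e\<close>

context
  fixes \<nu> :: complex
begin

abbreviation (input) E where "E \<equiv> lin (gue \<nu>)"

definition corr :: "complex \<Rightarrow> nat \<Rightarrow> nat \<Rightarrow> complex" where
  "corr c i j = E (sym_gen c i * sym_gen (- c) j)"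

lemma E_add_const_mult: "E ((ptr 0 + const c * of_nat n) * F) = (\<nu> + c * of_nat n) * E F"
  by (simp only: distrib_right lin_add lin_gue_ptr_0 mult.assoc lin_const_mult lin_of_nat_mult)

text \<open>Newton's recursion turns \<open>sym_gen c (Suc K)\<close> into products containing some
  \<open>ptr (Suc n)\<close>, to each of which a loop equation applies.\<close>

lemma E_sum_loop:
  assumes "c * c = 1"
  shows "c * of_nat (Suc K) * corr c (Suc K) j
    = E ((\<Sum>n\<le>K. split_sum n * sym_gen c (K - n) + vir_deriv n (sym_gen c (K
        - n))) * sym_gen (- c) j)
      - c * E (mix_sum c K j)"
proof -
  have "of_nat (Suc K) * corr c (Suc K) j
      = E (of_nat (Suc K) * sym_gen c (Suc K) * sym_gen (- c) j)"
    by (simp only: corr_def mult.assoc lin_of_nat_mult)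
  also have "\<dots> = c * E ((\<Sum>n\<le>K. ptr (Suc n) * sym_gen c (K - n)) * sym_gen (- c) j)"
    by (simp only: sym_gen_Suc mult.assoc lin_const_mult)
  finally have "c * of_nat (Suc K) * corr c (Suc K) j
      = c * c * E ((\<Sum>n\<le>K. ptr (Suc n) * sym_gen c (K - n)) * sym_gen (- c) j)"
    by simp
  also have "\<dots> = (\<Sum>n\<le>K. E (ptr (Suc n) * (sym_gen c (K - n) * sym_gen (- c) j)))"
    by (simp only: assms sum_distrib_right lin_sum mult.assoc) simp
  also have "\<dots> = E (\<Sum>n\<le>K. loop n (sym_gen c (K - n) * sym_gen (- c) j))"
    by (simp only: gue_loop lin_sum)
  also have "(\<Sum>n\<le>K. loop n (sym_gen c (K - n) * sym_gen (- c) j))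
      = (\<Sum>n\<le>K. split_sum n * sym_gen c (K - n) + vir_deriv n (sym_gen c (K
          - n))) * sym_gen (- c) j
        - const c * mix_sum c K j"
    unfolding mix_sum_def sum_distrib_left[of "const c"] sum_distrib_right
        sum_subtractf[symmetric]
    by (intro sum.cong)
      (simp_all add: loop_def vir_deriv_mult vir_deriv_sym_gen[of _ "- c"] single_uminus
          algebra_simps)
  finally show ?thesis by (simp only: lin_diff lin_const_mult)
qed

lemma corr_step_0:
  assumes "c * c = 1"
  shows "c * of_nat (K + 2) * corr c (K + 2) 0 = (\<nu> + c * of_nat (Suc K)) * (\<nu>
      + c * of_nat K) * corr c K 0"
proof -
  have "mix_sum c (Suc K) 0 = 0" by (simp add: mix_sum_def)
  then show ?thesis
    using E_sum_loop[OF assms, of "Suc K" 0]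
    unfolding loop_sum_sym_gen[OF assms] mult.assoc E_add_const_mult
    by (simp add: corr_def)
qed

definition lower_term :: "nat \<Rightarrow> nat \<Rightarrow> complex" where
  "lower_term K j = (if K = 0 then 0 else (\<nu> + of_nat K) * (\<nu> + of_nat (K - 1)) * corr 1 (K
      - 1) j)"

lemma E_loop_sum:
  "E ((\<Sum>n\<le>K. split_sum n * sym_gen 1 (K - n) + vir_deriv n (sym_gen 1 (K - n))) * sym_gen (- 1) j)
    = lower_term K j"
proof (cases K)
  case 0
  then show ?thesis by (simp add: lower_term_def split_sum_def)
next
  case (Suc k)
  have "(1::complex) * 1 = 1" by simp
  then show ?thesis
    unfolding Suc loop_sum_sym_gen[OF \<open>1 * 1 = 1\<close>] mult.assoc E_add_const_mult
    by (simp add: lower_term_def corr_def)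
qed

text \<open>The difference of \<open>E_sum_loop\<close> at \<open>(K, j + 1)\<close> and at
  \<open>(K + 1, j)\<close>, where the mixed sums combine into correlators.\<close>

lemma corr_step:
  "of_nat (Suc K) * corr 1 (Suc K) (Suc j) - of_nat (K + 2) * corr 1 (K + 2) j
    = lower_term K (Suc j) - lower_term (Suc K) j
      - ((\<nu> + of_nat K) * corr 1 K j
         - (if j = 0 then 0 else (\<nu> - of_nat (j - 1)) * corr 1 (Suc K) (j - 1)))"
proof -
  have "E (mix_sum 1 K (Suc j)) - E (mix_sum 1 (Suc K) j)
      = E ((\<Sum>n\<le>K. ptr n * sym_gen 1 (K - n)) * sym_gen (- 1) j)
       - E (sym_gen 1 (Suc K) * (\<Sum>k<j. ptr k * sym_gen (- 1) (j - 1 - k)))"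
    by (simp only: lin_diff[symmetric] mix_sum_diff)
  also have "E ((\<Sum>n\<le>K. ptr n * sym_gen 1 (K - n)) * sym_gen (- 1) j) = (\<nu>
      + of_nat K) * corr 1 K j"
    using E_add_const_mult[of 1 K] by (simp add: sum_ptr_sym_gen mult.assoc corr_def)
  also have "E (sym_gen 1 (Suc K) * (\<Sum>k<j. ptr k * sym_gen (- 1) (j - 1 - k)))
      = (if j = 0 then 0 else (\<nu> - of_nat (j - 1)) * corr 1 (Suc K) (j - 1))"
  proof (cases j)
    case (Suc i)
    have "E (sym_gen 1 (Suc K) * (\<Sum>k<j. ptr k * sym_gen (- 1) (j - 1 - k)))
        = E ((ptr 0 + const (-1) * of_nat i) * (sym_gen 1 (Suc K) * sym_gen (-1) i))"
      using sum_ptr_sym_gen[of "-1" i] by (simp add: Suc lessThan_Suc_atMost mult_ac)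
    then show ?thesis unfolding E_add_const_mult by (simp add: Suc corr_def)
  qed simp
  finally have diff: "E (mix_sum 1 K (Suc j)) - E (mix_sum 1 (Suc K) j) = (\<nu>
      + of_nat K) * corr 1 K j
      - (if j = 0 then 0 else (\<nu> - of_nat (j - 1)) * corr 1 (Suc K) (j - 1))" .
  have "of_nat (Suc K) * corr 1 (Suc K) (Suc j) = lower_term K (Suc j) - E (mix_sum 1 K (Suc j))"
    using E_sum_loop[of 1 K "Suc j"] by (simp only: E_loop_sum mult_1)
  moreover have "of_nat (K + 2) * corr 1 (K + 2) j = lower_term (Suc K) j
      - E (mix_sum 1 (Suc K) j)"
    using E_sum_loop[of 1 "Suc K" j] by (simp only: E_loop_sum mult_1 add_2_eq_Suc')
  ultimately show ?thesis
    by (simp only: diff[symmetric]) simp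
qed

lemma gue_conv_corr: "gue \<nu> {#Suc m#} = (\<Sum>i\<le>m. of_nat (Suc i) * corr 1 (Suc i) (m - i))"
proof -
  have "gue \<nu> {#Suc m#} = E (ptr (Suc m))" by (simp add: ptr_def)
  then show ?thesis
    by (simp only: ptr_conv_sym_gen[of m] lin_sum lin_of_nat_mult corr_def)
qed

end


section \<open>Closed form of the correlators\<close>

definition ffall :: "complex \<Rightarrow> nat \<Rightarrow> complex" where
  "ffall \<nu> n = (\<Prod>i<n. \<nu> - of_nat i)"

lemma ffall_Suc: "ffall \<nu> (Suc n) = ffall \<nu> n * (\<nu> - of_nat n)"
  by (simp add: ffall_def)

lemma ffall_0 [simp]: "ffall \<nu> 0 = 1"
  by (simp add: ffall_def)

definition hook_weight :: "nat \<Rightarrow> nat \<Rightarrow> complex" where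
  "hook_weight a b = (-1) ^ b / (2 ^ (a + b) * fact a * fact b)"

text \<open>For even indices the correlator factorizes: this is the product of the correlators of
  the two factors, which \<open>corr_step_0\<close> determines.\<close>

definition corr_even :: "complex \<Rightarrow> nat \<Rightarrow> nat \<Rightarrow> complex" where
  "corr_even \<nu> a b = hook_weight a b * pochhammer \<nu> (2 * a) * ffall \<nu> (2 * b)"

text \<open>A common measure for neighbouring correlators, through which \<open>corr_step\<close>
  becomes an identity of polynomial coefficients. Its relations to \<open>corr_even\<close> are
  stated in multiplied form, since \<open>\<nu> + of_nat (2 * a)\<close> may vanish.\<close>

definition corr_core :: "complex \<Rightarrow> nat \<Rightarrow> nat \<Rightarrow> complex" where
  "corr_core \<nu> a b = hook_weight a b * pochhammer (\<nu> + 1) (2 * a) * ffall \<nu> (2 * b)"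

definition corr_odd :: "complex \<Rightarrow> nat \<Rightarrow> nat \<Rightarrow> complex" where
  "corr_odd \<nu> a b = - (\<nu> - of_nat (2 * b)) * corr_core \<nu> a b"

lemma hook_weight_Suc_left: "2 * of_nat (Suc a) * hook_weight (Suc a) b = hook_weight a b"
proof -
  have "(2 * of_nat (Suc a)) * (2 ^ (a + b) * fact a * fact b) = 2 ^ (Suc a
      + b) * (fact (Suc a) :: complex) * fact b"
    by (simp add: algebra_simps)
  then show ?thesis
    unfolding hook_weight_def by (simp add: field_simps del: of_nat_Suc)
qed

lemma hook_weight_Suc_right: "2 * of_nat (Suc b) * hook_weight a (Suc b) = - hook_weight a b"
  unfolding hook_weight_def by (simp add: field_simps del: of_nat_Suc)

lemma corr_even_core: "(\<nu> + of_nat (2 * a)) * corr_even \<nu> a b = \<nu> * corr_core \<nu> a b"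
proof -
  have "pochhammer \<nu> (2 * a) * (\<nu> + of_nat (2 * a)) = \<nu> * pochhammer (\<nu> + 1) (2 * a)"
    using pochhammer_Suc[of \<nu> "2 * a"] pochhammer_rec[of \<nu> "2 * a"] by simp
  moreover have "(\<nu> + of_nat (2 * a)) * corr_even \<nu> a b
      = hook_weight a b * (pochhammer \<nu> (2 * a) * (\<nu> + of_nat (2 * a))) * ffall \<nu> (2 * b)"
    by (simp only: corr_even_def mult_ac)
  ultimately show ?thesis
    by (simp only: corr_core_def) (simp only: mult_ac)
qed

lemma corr_even_Suc_core:
  "of_nat (2 * a + 2) * corr_even \<nu> (Suc a) b = \<nu> * (\<nu> + of_nat (2 * a + 1)) * corr_core \<nu> a b"
proof -
  have "pochhammer \<nu> (2 * Suc a) = \<nu> * pochhammer (\<nu> + 1) (2 * a) * (\<nu> + of_nat (2 * a + 1))"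
    using pochhammer_rec[of \<nu> "Suc (2 * a)"] pochhammer_Suc[of "\<nu> + 1" "2 * a"]
    by (simp add: algebra_simps)
  moreover have "of_nat (2 * a + 2) * hook_weight (Suc a) b = hook_weight a b"
    using hook_weight_Suc_left[of a b] by (simp add: algebra_simps)
  ultimately show ?thesis
    unfolding corr_even_def corr_core_def by (simp only: mult.assoc[symmetric]) (simp only:
        mult_ac)
qed

lemma corr_core_Suc_left:
  "of_nat (2 * a + 2) * corr_core \<nu> (Suc a) b
     = (\<nu> + of_nat (2 * a + 1)) * (\<nu> + of_nat (2 * a + 2)) * corr_core \<nu> a b"
proof -
  have "pochhammer (\<nu> + 1) (2 * Suc a)
      = pochhammer (\<nu> + 1) (2 * a) * (\<nu> + of_nat (2 * a + 1)) * (\<nu> + of_nat (2 * a + 2))"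
    using pochhammer_Suc[of "\<nu> + 1" "Suc (2 * a)"] pochhammer_Suc[of "\<nu> + 1" "2 * a"]
    by (simp add: algebra_simps)
  moreover have "of_nat (2 * a + 2) * hook_weight (Suc a) b = hook_weight a b"
    using hook_weight_Suc_left[of a b] by (simp add: algebra_simps)
  ultimately show ?thesis
    unfolding corr_core_def by (simp only: mult.assoc[symmetric]) (simp only: mult_ac)
qed

lemma ffall_even_Suc:
  "ffall \<nu> (2 * Suc b) = ffall \<nu> (2 * b) * (\<nu> - of_nat (2 * b)) * (\<nu> - of_nat (2 * b + 1))"
  using ffall_Suc[of \<nu> "2 * b"] ffall_Suc[of \<nu> "Suc (2 * b)"] by simp

lemma corr_core_Suc_right:
  "of_nat (2 * b + 2) * corr_core \<nu> a (Suc b)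
     = - ((\<nu> - of_nat (2 * b)) * (\<nu> - of_nat (2 * b + 1)) * corr_core \<nu> a b)"
proof -
  have "of_nat (2 * b + 2) * hook_weight a (Suc b) = - hook_weight a b"
    using hook_weight_Suc_right[of b a] by (simp add: algebra_simps)
  then show ?thesis
    unfolding corr_core_def ffall_even_Suc
    by (simp only: mult.assoc[symmetric]) (simp only: mult_ac mult_minus_left mult_minus_right)
qed

lemma corr_even_Suc_right:
  "of_nat (2 * b + 2) * corr_even \<nu> a (Suc b)
     = - ((\<nu> - of_nat (2 * b)) * (\<nu> - of_nat (2 * b + 1)) * corr_even \<nu> a b)"
proof -
  have "of_nat (2 * b + 2) * hook_weight a (Suc b) = - hook_weight a b"
    using hook_weight_Suc_right[of b a] by (simp add: algebra_simps)
  then show ?thesis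
    unfolding corr_even_def ffall_even_Suc
    by (simp only: mult.assoc[symmetric]) (simp only: mult_ac mult_minus_left mult_minus_right)
qed

lemma lin_gue_one: "lin (gue \<nu>) 1 = 1"
proof -
  have "gue \<nu> {#} = 1" by (subst gue_zeros) auto
  then show ?thesis by (simp flip: basis_empty)
qed

lemma corr_left_0: "corr \<nu> 1 (2 * a) 0 = corr_even \<nu> a 0"
proof (induction a)
  case 0
  show ?case
    by (simp add: corr_def corr_even_def hook_weight_def lin_gue_one)
next
  case (Suc a)
  have "of_nat (2 * a + 2) * corr \<nu> 1 (2 * a + 2) 0
      = (\<nu> + of_nat (2 * a + 1)) * ((\<nu> + of_nat (2 * a)) * corr_even \<nu> a 0)"
    using corr_step_0[of 1 "2 * a" \<nu>] by (simp add: Suc)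
  also have "\<dots> = of_nat (2 * a + 2) * corr_even \<nu> (Suc a) 0"
    unfolding corr_even_core corr_even_Suc_core by simp
  finally have "of_nat (2 * a + 2) * corr \<nu> 1 (2 * a + 2) 0 = of_nat (2 * a
      + 2) * corr_even \<nu> (Suc a) 0" .
  then show ?case by (simp only: mult_cancel_left of_nat_eq_0_iff) simp
qed

lemma corr_0_right: "corr \<nu> 1 0 (2 * b) = corr_even \<nu> 0 b"
proof -
  \<comment> \<open>Changing the sign of \<open>c\<close> exchanges the two factors, so
    \<open>corr_step_0\<close> at -1 governs the correlators whose first index is 0.\<close>
  have "corr \<nu> (-1) (2 * b) 0 = corr_even \<nu> 0 b"
  proof (induction b)
    case 0
    show ?case
    by (simp add: corr_def corr_even_def hook_weight_def lin_gue_one)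
  next
    case (Suc b)
    have "- (of_nat (2 * b + 2) * corr \<nu> (-1) (2 * b + 2) 0)
        = (\<nu> - of_nat (2 * b + 1)) * (\<nu> - of_nat (2 * b)) * corr_even \<nu> 0 b"
      using corr_step_0[of "-1" "2 * b" \<nu>] unfolding Suc by (simp add: algebra_simps)
    then have "of_nat (2 * b + 2) * corr \<nu> (-1) (2 * b + 2) 0 = of_nat (2 * b
        + 2) * corr_even \<nu> 0 (Suc b)"
      unfolding corr_even_Suc_right by (simp only: minus_equation_iff mult_ac)
    then show ?case by (simp only: mult_cancel_left of_nat_eq_0_iff) simp
  qed
  then show ?thesis by (simp add: corr_def mult.commute)
qed

text \<open>\<open>corr_step\<close> at \<open>(2 * a, 2 * b)\<close>. The last two hypotheses are
  conditional because those neighbours drop out of it for \<open>a = 0\<close>, respectively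
  \<open>b = 0\<close>.\<close>

lemma corr_odd_step:
  assumes "corr \<nu> 1 (2 * a + 2) (2 * b) = corr_even \<nu> (Suc a) b"
    and "corr \<nu> 1 (2 * a) (2 * b) = corr_even \<nu> a b"
    and "\<And>a'. a = Suc a' \<Longrightarrow> corr \<nu> 1 (2 * a' + 1) (2 * b + 1) = corr_odd \<nu> a' b"
    and "\<And>b'. b = Suc b' \<Longrightarrow> corr \<nu> 1 (2 * a + 1) (2 * b' + 1) = corr_odd \<nu> a b'"
  shows "corr \<nu> 1 (2 * a + 1) (2 * b + 1) = corr_odd \<nu> a b"
proof -
  have 1: "lower_term \<nu> (2 * a) (Suc (2 * b)) = of_nat (2 * a) * corr_odd \<nu> a b"
  proof (cases a)
    case (Suc a')
    have "lower_term \<nu> (2 * a) (Suc (2 * b))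
        = (\<nu> + of_nat (2 * a' + 1)) * (\<nu> + of_nat (2 * a' + 2)) * corr_odd \<nu> a' b"
      using assms(3)[OF Suc] by (simp add: lower_term_def Suc)
    also have "\<dots> = - (\<nu> - of_nat (2 * b)) * (of_nat (2 * a' + 2) * corr_core \<nu> (Suc a') b)"
      unfolding corr_core_Suc_left by (simp add: corr_odd_def)
    finally show ?thesis by (simp add: corr_odd_def Suc)
  qed (simp add: lower_term_def)
  have 2: "(if 2 * b = 0 then 0 else (\<nu> - of_nat (2 * b - 1)) * corr \<nu> 1 (Suc (2 * a)) (2 * b
      - 1))
      = of_nat (2 * b) * corr_core \<nu> a b"
  proof (cases b)
    case (Suc b')
    have "(\<nu> - of_nat (2 * b - 1)) * corr \<nu> 1 (Suc (2 * a)) (2 * b - 1)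
        = - ((\<nu> - of_nat (2 * b')) * (\<nu> - of_nat (2 * b' + 1)) * corr_core \<nu> a b')"
      using assms(4)[OF Suc] by (simp add: Suc) (simp add: corr_odd_def algebra_simps)
    also have "\<dots> = of_nat (2 * b' + 2) * corr_core \<nu> a (Suc b')"
      by (rule corr_core_Suc_right[symmetric])
    finally show ?thesis by (simp add: Suc)
  qed simp
  have 3: "lower_term \<nu> (Suc (2 * a)) (2 * b) = (\<nu> + of_nat (2 * a + 1)) * (\<nu> * corr_core \<nu> a b)"
    using assms(2) by (simp add: lower_term_def flip: corr_even_core)
  have "of_nat (Suc (2 * a)) * corr \<nu> 1 (Suc (2 * a)) (Suc (2 * b)) - \<nu> * (\<nu> + of_nat (2 * a
      + 1)) * corr_core \<nu> a b
    = of_nat (2 * a) * corr_odd \<nu> a b - (\<nu> + of_nat (2 * a + 1)) * (\<nu> * corr_core \<nu> a b)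
      - (\<nu> * corr_core \<nu> a b - of_nat (2 * b) * corr_core \<nu> a b)"
    using corr_step[of "2 * a" \<nu> "2 * b"] unfolding 1 2 3 assms(1,2) corr_even_core
        corr_even_Suc_core .
  then have "of_nat (Suc (2 * a)) * corr \<nu> 1 (Suc (2 * a)) (Suc (2 * b))
      = of_nat (Suc (2 * a)) * corr_odd \<nu> a b"
    by (simp add: corr_odd_def algebra_simps)
  then show ?thesis by (simp only: mult_cancel_left of_nat_eq_0_iff) simp
qed

lemma corr_even_step:
  assumes "corr \<nu> 1 (2 * a + 3) (2 * b + 1) = corr_odd \<nu> (Suc a) b"
    and "corr \<nu> 1 (2 * a) (2 * b + 2) = corr_even \<nu> a (Suc b)"
    and "corr \<nu> 1 (2 * a + 1) (2 * b + 1) = corr_odd \<nu> a b"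
    and "corr \<nu> 1 (2 * a + 2) (2 * b) = corr_even \<nu> (Suc a) b"
  shows "corr \<nu> 1 (2 * a + 2) (2 * b + 2) = corr_even \<nu> (Suc a) (Suc b)"
proof -
  define x where "x = corr_core \<nu> a b"
  have nz: "of_nat (2 * a + 2) \<noteq> (0 :: complex)" by (simp only: of_nat_eq_0_iff)
  have "lower_term \<nu> (Suc (2 * a)) (Suc (Suc (2 * b))) = of_nat (2 * a
      + 2) * corr_even \<nu> (Suc a) (Suc b)"
    using assms(2) unfolding corr_even_Suc_core
    by (simp add: lower_term_def mult.commute[of \<nu>] flip: corr_even_core)
  moreover have "lower_term \<nu> (Suc (Suc (2 * a))) (Suc (2 * b))
      = (\<nu> + of_nat (2 * a + 2)) * (\<nu> + of_nat (2 * a + 1)) * corr_odd \<nu> a b"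
    using assms(3) by (simp add: lower_term_def)
  ultimately have eq: "of_nat (2 * a + 2) * corr \<nu> 1 (2 * a + 2) (2 * b + 2)
      - of_nat (2 * a + 3) * corr_odd \<nu> (Suc a) b
    = of_nat (2 * a + 2) * corr_even \<nu> (Suc a) (Suc b)
      - (\<nu> + of_nat (2 * a + 2)) * (\<nu> + of_nat (2 * a + 1)) * corr_odd \<nu> a b
      - ((\<nu> + of_nat (2 * a + 1)) * corr_odd \<nu> a b - (\<nu>
          - of_nat (2 * b)) * corr_even \<nu> (Suc a) b)"
    using corr_step[of "Suc (2 * a)" \<nu> "Suc (2 * b)"] assms(1,3,4)
    by (simp add: numeral_3_eq_3)
  have "of_nat (2 * a + 3) * corr_core \<nu> (Suc a) b
      = (\<nu> + of_nat (2 * a + 1)) * (\<nu> + of_nat (2 * a + 3)) * x + corr_even \<nu> (Suc a) b"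
  proof -
    have "of_nat (2 * a + 2) * (of_nat (2 * a + 3) * corr_core \<nu> (Suc a) b)
        = of_nat (2 * a + 3) * (of_nat (2 * a + 2) * corr_core \<nu> (Suc a) b)"
      by (rule mult.left_commute)
    also have "\<dots> = of_nat (2 * a + 3) * ((\<nu> + of_nat (2 * a + 1)) * (\<nu> + of_nat (2 * a + 2)) * x)"
      unfolding corr_core_Suc_left x_def ..
    \<comment> \<open>By (2a + 3)(\<nu> + 2a + 2) = (2a + 2)(\<nu> + 2a + 3) + \<nu>; the last
      summand is what becomes \<open>corr_even \<nu> (Suc a) b\<close>.\<close>
    also have "\<dots> = of_nat (2 * a + 2) * ((\<nu> + of_nat (2 * a + 1)) * (\<nu> + of_nat (2 * a + 3)) * x)
        + \<nu> * (\<nu> + of_nat (2 * a + 1)) * x"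
      by (simp add: algebra_simps)
    also have "\<dots> = of_nat (2 * a + 2) * ((\<nu> + of_nat (2 * a + 1)) * (\<nu> + of_nat (2 * a + 3)) * x
        + corr_even \<nu> (Suc a) b)"
      by (simp only: x_def distrib_left corr_even_Suc_core)
    finally show ?thesis by (simp only: mult_left_cancel[OF nz])
  qed
  then have "of_nat (2 * a + 3) * corr_odd \<nu> (Suc a) b = - (\<nu> - of_nat (2 * b)) *
      ((\<nu> + of_nat (2 * a + 1)) * (\<nu> + of_nat (2 * a + 3)) * x + corr_even \<nu> (Suc a) b)"
    by (simp only: corr_odd_def mult.left_commute)
  then have "of_nat (2 * a + 3) * corr_odd \<nu> (Suc a) b
    = (\<nu> + of_nat (2 * a + 2)) * (\<nu> + of_nat (2 * a + 1)) * corr_odd \<nu> a b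
      + ((\<nu> + of_nat (2 * a + 1)) * corr_odd \<nu> a b - (\<nu>
          - of_nat (2 * b)) * corr_even \<nu> (Suc a) b)"
    unfolding corr_odd_def[of \<nu> a b] x_def[symmetric] by (simp only:) (simp add: algebra_simps)
  with eq have "of_nat (2 * a + 2) * corr \<nu> 1 (2 * a + 2) (2 * b + 2)
      = of_nat (2 * a + 2) * corr_even \<nu> (Suc a) (Suc b)"
    by (simp only: diff_diff_eq diff_eq_eq diff_add_cancel)
  then show ?thesis by (simp only: mult_left_cancel[OF nz])
qed

text \<open>\<open>N\<close> is half the total degree. At fixed degree \<open>corr_step\<close>
  moves from second index \<open>j\<close> to \<open>j + 1\<close>, starting at
  \<open>corr_left_0\<close> and using lower degrees otherwise; hence the inner induction on
  \<open>b\<close>, alternating between odd and even. The recurrence never reaches first index 0,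
  which \<open>corr_0_right\<close> supplies.\<close>

lemma corr_closed_form:
  "(\<forall>a b. a + b = N \<longrightarrow> corr \<nu> 1 (2 * a) (2 * b) = corr_even \<nu> a b) \<and>
   (\<forall>a b. Suc (a + b) = N \<longrightarrow> corr \<nu> 1 (2 * a + 1) (2 * b + 1) = corr_odd \<nu> a b)"
proof (induction N)
  case 0
  show ?case using corr_left_0[of \<nu> 0] by simp
next
  case (Suc N)
  have IH_even: "corr \<nu> 1 (2 * a) (2 * b) = corr_even \<nu> a b" if "a + b = N" for a b
    using Suc that by blast
  have IH_odd: "corr \<nu> 1 (2 * a + 1) (2 * b + 1) = corr_odd \<nu> a b" if "Suc (a + b) = N" for a b
    using Suc that by blast
  have "(\<forall>a. a + b = Suc N \<longrightarrow> corr \<nu> 1 (2 * a) (2 * b) = corr_even \<nu> a b) \<and>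
      (\<forall>a. a + b = N \<longrightarrow> corr \<nu> 1 (2 * a + 1) (2 * b + 1) = corr_odd \<nu> a b)" for b
  proof (induction b)
    case 0
    have "corr \<nu> 1 (2 * N + 1) (2 * 0 + 1) = corr_odd \<nu> N 0"
    proof (rule corr_odd_step)
      show "corr \<nu> 1 (2 * N + 2) (2 * 0) = corr_even \<nu> (Suc N) 0"
        using corr_left_0[of \<nu> "Suc N"] by simp
      show "corr \<nu> 1 (2 * N) (2 * 0) = corr_even \<nu> N 0"
        using corr_left_0[of \<nu> N] by simp
    qed (use IH_odd[of _ 0] in simp_all)
    then show ?case using corr_left_0[of \<nu> "Suc N"] by simp
  next
    case (Suc b)
    have even: "corr \<nu> 1 (2 * a) (2 * Suc b) = corr_even \<nu> a (Suc b)" if a: "a + Suc b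
        = Suc N" for a
    proof (cases a)
      case 0
      then show ?thesis using corr_0_right[of \<nu> "Suc b"] by simp
    next
      case a': (Suc a')
      have sums: "Suc a' + b = N" "a' + Suc b = N" "Suc a' + b = N" "Suc (a' + b) = N"
        "Suc (Suc a') + b = Suc N" using a a' by auto
      have "corr \<nu> 1 (2 * a' + 2) (2 * b + 2) = corr_even \<nu> (Suc a') (Suc b)"
      proof (rule corr_even_step)
        have "corr \<nu> 1 (2 * Suc a' + 1) (2 * b + 1) = corr_odd \<nu> (Suc a') b"
          using Suc.IH sums(1) by blast
        then show "corr \<nu> 1 (2 * a' + 3) (2 * b + 1) = corr_odd \<nu> (Suc a') b"
          by (simp add: numeral_3_eq_3)
        show "corr \<nu> 1 (2 * a') (2 * b + 2) = corr_even \<nu> a' (Suc b)"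
          using IH_even[OF sums(2)] by simp
        show "corr \<nu> 1 (2 * a' + 1) (2 * b + 1) = corr_odd \<nu> a' b"
          by (rule IH_odd[OF sums(4)])
        show "corr \<nu> 1 (2 * a' + 2) (2 * b) = corr_even \<nu> (Suc a') b"
          using IH_even[OF sums(1)] by simp
      qed
      then show ?thesis using a' by simp
    qed
    have "corr \<nu> 1 (2 * a + 1) (2 * Suc b + 1) = corr_odd \<nu> a (Suc b)" if a: "a + Suc b = N" for a
    proof (rule corr_odd_step)
      show "corr \<nu> 1 (2 * a + 2) (2 * Suc b) = corr_even \<nu> (Suc a) (Suc b)"
        using even[of "Suc a"] a by simp
      show "corr \<nu> 1 (2 * a) (2 * Suc b) = corr_even \<nu> a (Suc b)"
        using IH_even[OF a] .
      show "corr \<nu> 1 (2 * a' + 1) (2 * Suc b + 1) = corr_odd \<nu> a' (Suc b)" if "a = Suc a'" for a'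
        using IH_odd[of a' "Suc b"] a that by simp
      show "corr \<nu> 1 (2 * a + 1) (2 * b' + 1) = corr_odd \<nu> a b'" if "Suc b = Suc b'" for b'
        using IH_odd[of a b] a that by simp
    qed
    then show ?case using even by blast
  qed
  then show ?case by blast
qed


section \<open>The Harer--Zagier numbers\<close>

definition gbin :: "nat \<Rightarrow> complex \<Rightarrow> complex" where
  "gbin m x = x gchoose m"

lemma gbin_Suc: "gbin (Suc m) (x + 1) = gbin m x + gbin (Suc m) x"
  by (simp add: gbin_def gbinomial_Suc_Suc)

lemma sum_binomial_Suc:
  fixes g :: "nat \<Rightarrow> complex"
  shows "(\<Sum>j\<le>Suc k. of_nat (Suc k choose j) * g j) = (\<Sum>j\<le>k. of_nat (k choose j) * (g j
      + g (Suc j)))"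
proof -
  have "(\<Sum>j\<le>Suc k. of_nat (Suc k choose j) * g j)
      = g 0 + (\<Sum>j\<le>k. of_nat (k choose Suc j) * g (Suc j))
          + (\<Sum>j\<le>k. of_nat (k choose j) * g (Suc j))"
    by (subst sum.atMost_Suc_shift) (simp add: distrib_right sum.distrib)
  also have "g 0 + (\<Sum>j\<le>k. of_nat (k choose Suc j) * g (Suc j))
      = (\<Sum>j\<le>Suc k. of_nat (k choose j) * g j)"
    by (subst sum.atMost_Suc_shift) simp
  finally show ?thesis
    by (simp add: distrib_left sum.distrib)
qed

text \<open>The operator (S^2 - 1)^k, with S the shift by one; \<open>shift_sum k\<close> is (S +
  1)^k.\<close>

definition diff2_sum :: "nat \<Rightarrow> (complex \<Rightarrow> complex) \<Rightarrow> complex \<Rightarrow> complex" where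
  "diff2_sum k f x = (\<Sum>a\<le>k. of_nat (k choose a) * ((-1) ^ (k - a) * f (x + of_nat (2 * a))))"

definition shift_sum :: "nat \<Rightarrow> (complex \<Rightarrow> complex) \<Rightarrow> complex \<Rightarrow> complex" where
  "shift_sum k f x = (\<Sum>j\<le>k. of_nat (k choose j) * f (x + of_nat j))"

lemma shift_sum_Suc: "shift_sum (Suc k) f x = shift_sum k f x + shift_sum k f (x + 1)"
  unfolding shift_sum_def sum_binomial_Suc by (simp add: sum.distrib distrib_left add_ac)

lemma diff2_sum_Suc: "diff2_sum (Suc k) f x = diff2_sum k (\<lambda>y. f (y + 2) - f y) x"
proof -
  have sgn: "(-1) ^ (k - a) = ((-1) ^ k * (-1) ^ a :: complex)" if "a \<le> k" for k a
  proof -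
    have "(-1) ^ k = ((-1) ^ (k - a) * (-1) ^ a :: complex)"
      using that by (simp flip: power_add)
    then show ?thesis by (simp add: mult.assoc flip: power_mult_distrib)
  qed
  have "diff2_sum (Suc k) f x
      = (\<Sum>a\<le>Suc k. of_nat (Suc k choose a) * ((-1) ^ Suc k * (-1) ^ a * f (x + of_nat (2 * a))))"
    unfolding diff2_sum_def by (intro sum.cong) (simp_all only: sgn atMost_iff)
  also have "\<dots> = (\<Sum>a\<le>k. of_nat (k choose a) * ((-1) ^ (k - a) *
      (f (x + of_nat (2 * a) + 2) - f (x + of_nat (2 * a)))))"
    unfolding sum_binomial_Suc by (intro sum.cong) (simp_all add: sgn algebra_simps)
  finally show ?thesis by (simp only: diff2_sum_def)
qed

lemma diff2_sum_add: "diff2_sum k (\<lambda>y. f y + g y) x = diff2_sum k f x + diff2_sum k g x"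
  by (simp add: diff2_sum_def sum.distrib algebra_simps)

lemma diff2_sum_shift: "diff2_sum k (\<lambda>y. f (y + 1)) x = diff2_sum k f (x + 1)"
  by (simp add: diff2_sum_def add_ac)

lemma gbin_diff2: "gbin (Suc m) (y + 2) - gbin (Suc m) y = gbin m y + gbin m (y + 1)"
  using gbin_Suc[of m y] gbin_Suc[of m "y + 1"] by (simp add: add.assoc)

text \<open>S^2 - 1 = (S - 1)(S + 1), and S - 1 lowers the lower index of a binomial coefficient by
  one.\<close>

lemma diff2_sum_gbin: "diff2_sum k (gbin (m + k)) x = shift_sum k (gbin m) x"
proof (induction k arbitrary: x)
  case 0
  show ?case by (simp add: diff2_sum_def shift_sum_def)
next
  case (Suc k)
  have "diff2_sum (Suc k) (gbin (m + Suc k)) x = diff2_sum k (\<lambda>y. gbin (m + k) y + gbin (m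
      + k) (y + 1)) x"
    unfolding diff2_sum_Suc add_Suc_right gbin_diff2 ..
  also have "\<dots> = shift_sum (Suc k) (gbin m) x"
    unfolding diff2_sum_add diff2_sum_shift Suc shift_sum_Suc ..
  finally show ?case .
qed

text \<open>The binomial expansion of S + 1 = 2 + (S - 1).\<close>

lemma shift_sum_gbin: "shift_sum k (gbin (m + k)) x
    = (\<Sum>j\<le>k. of_nat (k choose j) * (2 ^ j * gbin (m + j) x))"
proof (induction k arbitrary: m)
  case 0
  show ?case by (simp add: shift_sum_def)
next
  case (Suc k)
  have "shift_sum (Suc k) (gbin (m + Suc k)) x
      = 2 * shift_sum k (gbin (Suc m + k)) x + shift_sum k (gbin (m + k)) x"
  proof -
    have "gbin (m + Suc k) (x + 1 + of_nat j)
        = gbin (m + k) (x + of_nat j) + gbin (m + Suc k) (x + of_nat j)" for j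
      using gbin_Suc[of "m + k" "x + of_nat j"] by (simp add: add_ac)
    then have "shift_sum k (gbin (m + Suc k)) (x + 1)
        = shift_sum k (gbin (m + k)) x + shift_sum k (gbin (m + Suc k)) x"
      unfolding shift_sum_def by (simp add: distrib_left sum.distrib)
    then show ?thesis unfolding shift_sum_Suc by simp
  qed
  also have "\<dots> = (\<Sum>j\<le>Suc k. of_nat (Suc k choose j) * (2 ^ j * gbin (m + j) x))"
    unfolding sum_binomial_Suc Suc by (simp add: sum.distrib sum_distrib_left algebra_simps)
  finally show ?case .
qed

definition hz_seq :: "complex \<Rightarrow> nat \<Rightarrow> complex" where
  "hz_seq x k = shift_sum k (gbin (k + 1)) x"

lemma hz_seq_eq: "hz_seq x k = (\<Sum>j\<le>k. of_nat (k choose j) * (2 ^ j * gbin (Suc j) x))"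
  using shift_sum_gbin[of k 1 x] by (simp add: hz_seq_def add.commute)

lemma gbin_mult: "x * gbin m x = of_nat (Suc m) * gbin (Suc m) x + of_nat m * gbin m x"
  unfolding gbin_def by (simp only: gbinomial_mult_1 add.commute)

text \<open>Multiplication by \<open>2 * x\<close> sends \<open>w j\<close> to a combination of
  \<open>w j\<close> and \<open>w (Suc j)\<close>. Comparing coefficients leaves an identity of
  binomial coefficients, which follows from Pascal's rule and absorption.\<close>

lemma hz_seq_recurrence:
  "of_nat (k + 3) * hz_seq x (k + 2) = 2 * x * hz_seq x (k + 1) + of_nat (k + 1) * hz_seq x k"
proof -
  define w where "w j = 2 ^ j * gbin (Suc j) x" for j
  have w: "2 * x * w j = of_nat (j + 2) * w (Suc j) + 2 * of_nat (j + 1) * w j" for j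
  proof -
    have "2 * x * w j = 2 * 2 ^ j * (x * gbin (Suc j) x)" by (simp add: w_def)
    then show ?thesis unfolding gbin_mult[of x "Suc j"] by (simp add: w_def algebra_simps)
  qed
  have ext: "hz_seq x i = (\<Sum>j\<le>k+2. of_nat (i choose j) * w j)" if "i \<le> k + 2" for i
    unfolding hz_seq_eq w_def[symmetric] by (rule sum.mono_neutral_left) (use that in auto)
  have "2 * x * hz_seq x (k + 1)
      = (\<Sum>j\<le>k+1. of_nat (k + 1 choose j) * (of_nat (j + 2) * w (Suc j)))
        + (\<Sum>j\<le>k+1. of_nat (k + 1 choose j) * (2 * of_nat (j + 1) * w j))"
    unfolding hz_seq_eq w_def[symmetric] sum_distrib_left sum.distrib[symmetric]
        distrib_left[symmetric] w[symmetric]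
    by (simp only: mult_ac)
  also have "(\<Sum>j\<le>k+1. of_nat (k + 1 choose j) * (of_nat (j + 2) * w (Suc j)))
      = (\<Sum>j\<le>k+2. (if j = 0 then 0 else of_nat (k + 1 choose (j - 1)) * of_nat (j + 1)) * w j)"
    unfolding add_2_eq_Suc' by (subst sum.atMost_Suc_shift) (simp add: mult.assoc)
  also have "(\<Sum>j\<le>k+1. of_nat (k + 1 choose j) * (2 * of_nat (j + 1) * w j))
      = (\<Sum>j\<le>k+2. of_nat (k + 1 choose j) * (2 * of_nat (j + 1) * w j))"
    by (rule sum.mono_neutral_left) auto
  finally have shifted: "2 * x * hz_seq x (k + 1)
    = (\<Sum>j\<le>k+2. (if j = 0 then 0 else of_nat (k + 1 choose (j - 1)) * of_nat (j + 1)) * w j)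
      + (\<Sum>j\<le>k+2. of_nat (k + 1 choose j) * (2 * of_nat (j + 1) * w j))" .
  have "of_nat (k + 1) * hz_seq x k = (\<Sum>j\<le>k+2. of_nat (k + 1) * (of_nat (k choose j) * w j))"
    unfolding sum_distrib_left[symmetric] by (subst ext) simp_all
  then have "2 * x * hz_seq x (k + 1) + of_nat (k + 1) * hz_seq x k
    = (\<Sum>j\<le>k+2. ((if j = 0 then 0 else of_nat (k + 1 choose (j - 1)) * of_nat (j + 1))
        + of_nat (k + 1 choose j) * (2 * of_nat (j + 1)) + of_nat (k
            + 1) * of_nat (k choose j)) * w j)"
    unfolding shifted by (simp only: sum.distrib distrib_right mult.assoc)
  also have "\<dots> = (\<Sum>j\<le>k+2. of_nat (k + 3) * of_nat (k + 2 choose j) * w j)"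
  proof (intro sum.cong refl arg_cong2[where f = "(*)"])
    fix j assume "j \<in> {..k+2}"
    show "(if j = 0 then 0 else of_nat (k + 1 choose (j - 1)) * of_nat (j + 1))
        + of_nat (k + 1 choose j) * (2 * of_nat (j + 1)) + of_nat (k + 1) * of_nat (k choose j)
      = (of_nat (k + 3) * of_nat (k + 2 choose j) :: complex)"
    proof (cases j)
      case (Suc i)
      have absorb: "of_nat (Suc n) * of_nat (n choose j) = (of_nat (Suc n)
          - of_nat j) * (of_nat (Suc n choose j) :: complex)" for n
      proof (cases "j \<le> Suc n")
        case True
        have "Suc n * (n choose j) = (Suc n - j) * (Suc n choose j)"
          using binomial_absorb_comp[of "Suc n" j] by simp
        then have "of_nat (Suc n * (n choose j)) = (of_nat ((Suc n
            - j) * (Suc n choose j)) :: complex)"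
          by (rule arg_cong)
        then show ?thesis using True by (simp only: of_nat_mult of_nat_diff)
      qed (simp add: binomial_eq_0)
      have 1: "of_nat (k + 1) * of_nat (k choose j) = (of_nat (k + 1) - of_nat j) * (of_nat (k
          + 1 choose j) :: complex)"
        using absorb[of k] by (simp only: Suc_eq_plus1)
      have 2: "of_nat (k + 2) * of_nat (k + 1 choose j) = (of_nat (k + 2)
          - of_nat j) * (of_nat (k + 2 choose j) :: complex)"
        using absorb[of "k + 1"] by (simp only: Suc_eq_plus1 add.assoc one_add_one)
      have 3: "of_nat (k + 2 choose j) = (of_nat (k + 1 choose i) + of_nat (k
          + 1 choose j) :: complex)"
        by (simp add: Suc)
      show ?thesis
        unfolding 1 using 2 unfolding 3 by (simp add: Suc algebra_simps)
    qed simp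
  qed
  finally show ?thesis
    unfolding ext[OF order_refl] by (simp only: sum_distrib_left mult.assoc)
qed


section \<open>Expansion in hooks and the one-point correlators\<close>

definition hook_coeff :: "nat \<Rightarrow> nat \<Rightarrow> complex" where
  "hook_coeff k a = of_nat (k - 1 choose a) * (-1) ^ (k - 1 - a) / (2 ^ k * fact k)"

text \<open>With \<open>k = a + b + 1\<close>, the weight of a correlator becomes a signed binomial
  coefficient, so that sums over \<open>a\<close> turn into instances of
  \<open>diff2_sum (k - 1)\<close>.\<close>

lemma hook_coeff_conv_weight:
  "of_nat (2 * Suc (a + b)) * hook_coeff (Suc (a + b)) a = hook_weight a b"
proof -
  have "of_nat (a + b choose a) = (fact (a + b) / (fact a * fact b) :: complex)"
    by (simp add: binomial_fact)
  moreover have "of_nat (2 * Suc (a + b)) * fact (a + b) / (2 ^ Suc (a + b) * fact (Suc (a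
      + b))) = (1 / 2 ^ (a + b) :: complex)"
  proof -
    have "of_nat (2 * Suc (a + b)) = (2 * of_nat (Suc (a + b)) :: complex)"
      by (simp only: of_nat_mult of_nat_numeral)
    then show ?thesis by (simp only:) (simp add: field_simps del: of_nat_Suc)
  qed
  moreover have "of_nat (2 * Suc (a + b)) * hook_coeff (Suc (a + b)) a
      = of_nat (a + b choose a) * (fact a * fact b) / fact (a
          + b) * ((-1) ^ b / (fact a * fact b))
        * (of_nat (2 * Suc (a + b)) * fact (a + b) / (2 ^ Suc (a + b) * fact (Suc (a + b))))"
    unfolding hook_coeff_def by (simp del: of_nat_Suc fact_Suc power_Suc of_nat_mult)
  ultimately show ?thesis
    unfolding hook_weight_def by (simp only:) simp
qed

lemma hook_coeff_Suc:
  "of_nat (Suc a) * hook_coeff (Suc (a + b)) (Suc a) = - of_nat b * hook_coeff (Suc (a + b)) a"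
proof (cases b)
  case 0
  then show ?thesis by (simp add: hook_coeff_def)
next
  case (Suc b')
  have "Suc a * (a + b choose Suc a) = b * (a + b choose a)"
    using binomial_absorption[of a "a + b"] binomial_absorb_comp[of "a + b" a] by simp
  then have "of_nat (Suc a) * of_nat (a + b choose Suc a) = (of_nat b * of_nat (a
      + b choose a) :: complex)"
    by (metis of_nat_mult)
  moreover have "a + b - Suc a = b'" "a + b - a = Suc b'" using Suc by auto
  moreover define D :: complex where "D = 2 ^ Suc (a + b) * fact (Suc (a + b))"
  ultimately have "of_nat (Suc a) * hook_coeff (Suc (a + b)) (Suc a)
      = of_nat b * of_nat (a + b choose a) * ((-1) ^ b' / D)"
    "hook_coeff (Suc (a + b)) a = - of_nat (a + b choose a) * ((-1) ^ b' / D)"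
    by (simp_all add: hook_coeff_def D_def mult.assoc[symmetric] del: of_nat_Suc fact_Suc)
  then show ?thesis by simp
qed

text \<open>For \<open>a < n\<close> this is the product of \<nu> + c over the contents c of the
  hook of size \<open>n\<close> with arm \<open>a\<close>, divided into positive and nonpositive
  contents.\<close>

lemma fact_mult_gbin:
  assumes "a \<le> n"
  shows "fact n * gbin n (\<nu> + of_nat a) = pochhammer (\<nu> + 1) a * ffall \<nu> (n - a)"
proof -
  have "fact n * gbin n (\<nu> + of_nat a) = (\<Prod>i<n. \<nu> + of_nat a - of_nat i)"
    by (simp add: gbin_def gbinomial_mult_fact atLeast0LessThan)
  also have "\<dots> = (\<Prod>i<a. \<nu> + of_nat a - of_nat i) * (\<Prod>i=a..<n. \<nu> + of_nat a - of_nat i)"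
    using assms by (simp add: prod.atLeastLessThan_concat flip: atLeast0LessThan)
  also have "(\<Prod>i<a. \<nu> + of_nat a - of_nat i) = pochhammer (\<nu> + 1) a"
    unfolding pochhammer_prod atLeast0LessThan
    by (rule prod.reindex_bij_witness[of _ "\<lambda>i. a - 1 - i" "\<lambda>i. a - 1
        - i"]) (auto simp: of_nat_diff)
  also have "(\<Prod>i=a..<n. \<nu> + of_nat a - of_nat i) = ffall \<nu> (n - a)"
    unfolding ffall_def
    by (rule prod.reindex_bij_witness[of _ "\<lambda>i. i + a" "\<lambda>i. i - a"]) (auto simp: of_nat_diff)
  finally show ?thesis .
qed

text \<open>Up to sign the correlator of the Schur function of the hook of size \<open>2k\<close> with arm
  \<open>2a + e\<close>; the product \<open>h\<^sub>i e\<^sub>j\<close> is a sum of two such functions.\<close>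

definition hook_term :: "complex \<Rightarrow> nat \<Rightarrow> nat \<Rightarrow> nat \<Rightarrow> complex" where
  "hook_term \<nu> k a e = hook_coeff k a * (fact (2 * k) * gbin (2 * k) (\<nu> + of_nat (2 * a + e)))"

lemma hook_terms:
  defines "x \<equiv> (\<lambda>a b \<nu>. pochhammer (\<nu> + 1) (2 * a) * ffall \<nu> (2 * b))"
  shows "hook_term \<nu> (Suc (a + b)) a 0
      = hook_coeff (Suc (a + b)) a * ((\<nu> - of_nat (2 * b)) * (\<nu> - of_nat (2 * b + 1)) * x a b \<nu>)"
    and "hook_term \<nu> (Suc (a + b)) a 1
      = hook_coeff (Suc (a + b)) a * ((\<nu> + of_nat (2 * a + 1)) * (\<nu> - of_nat (2 * b)) * x a b \<nu>)"
    and "hook_term \<nu> (Suc (a + b)) (Suc a) 0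
      = hook_coeff (Suc (a + b)) (Suc a) * ((\<nu> + of_nat (2 * a + 1)) * (\<nu> + of_nat (2 * a
          + 2)) * x a b \<nu>)"
proof -
  have p: "pochhammer (\<nu> + 1) (2 * a + 1) = pochhammer (\<nu> + 1) (2 * a) * (\<nu> + of_nat (2 * a + 1))"
    using pochhammer_Suc[of "\<nu> + 1" "2 * a"] by (simp add: algebra_simps)
  have p': "pochhammer (\<nu> + 1) (2 * Suc a + 0)
      = pochhammer (\<nu> + 1) (2 * a) * (\<nu> + of_nat (2 * a + 1)) * (\<nu> + of_nat (2 * a + 2))"
    using pochhammer_Suc[of "\<nu> + 1" "Suc (2 * a)"] p by (simp add: algebra_simps)
  have f: "ffall \<nu> (Suc (2 * b)) = ffall \<nu> (2 * b) * (\<nu> - of_nat (2 * b))"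
    by (rule ffall_Suc)
  have d: "2 * Suc (a + b) - (2 * a + 0) = 2 * Suc b" "2 * Suc (a + b) - (2 * a + 1)
      = Suc (2 * b)"
    "2 * Suc (a + b) - (2 * Suc a + 0) = 2 * b" by auto
  have le: "2 * a + 0 \<le> 2 * Suc (a + b)" "2 * a + 1 \<le> 2 * Suc (a + b)" "2 * Suc a
      + 0 \<le> 2 * Suc (a + b)"
    by auto
  show "hook_term \<nu> (Suc (a + b)) a 0
      = hook_coeff (Suc (a + b)) a * ((\<nu> - of_nat (2 * b)) * (\<nu> - of_nat (2 * b + 1)) * x a b \<nu>)"
    unfolding hook_term_def fact_mult_gbin[OF le(1)] d ffall_even_Suc x_def by (simp only:
        add_0_right mult_ac)
  show "hook_term \<nu> (Suc (a + b)) a 1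
      = hook_coeff (Suc (a + b)) a * ((\<nu> + of_nat (2 * a + 1)) * (\<nu> - of_nat (2 * b)) * x a b \<nu>)"
    unfolding hook_term_def fact_mult_gbin[OF le(2)] d f p x_def by (simp only: mult_ac)
  show "hook_term \<nu> (Suc (a + b)) (Suc a) 0
      = hook_coeff (Suc (a + b)) (Suc a) * ((\<nu> + of_nat (2 * a + 1)) * (\<nu> + of_nat (2 * a
          + 2)) * x a b \<nu>)"
    unfolding hook_term_def fact_mult_gbin[OF le(3)] d p' x_def by (simp only: mult_ac)
qed

text \<open>Pieri's rule: the product of h and e with indices \<open>2 * a + 1\<close> and
  \<open>2 * b + 1\<close> is the sum of the hooks with arms \<open>2 * a\<close> and
  \<open>2 * a + 1\<close>. In \<open>corr_even_conv_hook\<close> the arms are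
  \<open>2 * a + 1\<close> and \<open>2 * a + 2\<close>.\<close>

lemma corr_odd_conv_hook:
  "corr_odd \<nu> a b = hook_term \<nu> (Suc (a + b)) a 0 - hook_term \<nu> (Suc (a + b)) a 1"
  unfolding hook_terms corr_odd_def corr_core_def hook_coeff_conv_weight[symmetric]
  by (simp add: algebra_simps)

lemma corr_even_conv_hook:
  "corr_even \<nu> (Suc a) b = hook_term \<nu> (Suc (a + b)) a 1 - hook_term \<nu> (Suc (a + b)) (Suc a) 0"
proof -
  define c where "c = hook_coeff (Suc (a + b)) a"
  define y where "y = (\<nu> + of_nat (2 * a + 1)) * (pochhammer (\<nu> + 1) (2 * a) * ffall \<nu> (2 * b))"
  have "of_nat (Suc a) * (hook_term \<nu> (Suc (a + b)) a 1 - hook_term \<nu> (Suc (a + b)) (Suc a) 0)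
      = of_nat (Suc a) * c * ((\<nu> - of_nat (2 * b)) * y)
        - of_nat (Suc a) * hook_coeff (Suc (a + b)) (Suc a) * ((\<nu> + of_nat (2 * a + 2)) * y)"
    unfolding hook_terms c_def y_def by (simp only: right_diff_distrib mult_ac)
  \<comment> \<open>By (a + 1)(\<nu> - 2b) + b(\<nu> + 2a + 2) = (a + b + 1)\<nu>.\<close>
  also have "\<dots> = of_nat (Suc (a + b)) * c * \<nu> * y"
    unfolding hook_coeff_Suc c_def[symmetric] by (simp add: algebra_simps)
  finally have scaled: "of_nat (Suc a) * (hook_term \<nu> (Suc (a + b)) a 1 - hook_term \<nu> (Suc (a
      + b)) (Suc a) 0)
      = of_nat (Suc (a + b)) * c * \<nu> * y" .
  have "of_nat (2 * a + 2) * (hook_term \<nu> (Suc (a + b)) a 1 - hook_term \<nu> (Suc (a + b)) (Suc a) 0)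
      = of_nat (2 * Suc (a + b)) * c * (\<nu> * y)"
  proof -
    have "of_nat (2 * a + 2) = (2 * of_nat (Suc a) :: complex)"
      "of_nat (2 * Suc (a + b)) = (2 * of_nat (Suc (a + b)) :: complex)"
      by simp_all
    then show ?thesis using scaled by (simp only: mult.assoc)
  qed
  also have "\<dots> = of_nat (2 * a + 2) * corr_even \<nu> (Suc a) b"
    unfolding c_def hook_coeff_conv_weight corr_even_Suc_core corr_core_def y_def by (simp only:
        mult_ac)
  finally have eq: "of_nat (2 * a + 2) * (hook_term \<nu> (Suc (a + b)) a 1 - hook_term \<nu> (Suc (a
      + b)) (Suc a) 0)
      = of_nat (2 * a + 2) * corr_even \<nu> (Suc a) b" .
  have nz: "of_nat (2 * a + 2) \<noteq> (0 :: complex)" by (simp only: of_nat_eq_0_iff)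
  show ?thesis using eq by (simp only: mult_left_cancel[OF nz])
qed

lemma sum_even_odd:
  fixes f :: "nat \<Rightarrow> 'a::comm_monoid_add"
  shows "(\<Sum>i\<le>Suc (2 * K). f i) = (\<Sum>a\<le>K. f (2 * a) + f (Suc (2 * a)))"
  by (induction K) (simp_all add: add.assoc)

text \<open>The double factorial (2k - 1)!!.\<close>

definition odd_fact :: "nat \<Rightarrow> complex" where
  "odd_fact k = fact (2 * k) / (2 ^ k * fact k)"

lemma odd_fact_Suc: "odd_fact (Suc k) = of_nat (2 * k + 1) * odd_fact k"
proof -
  have "2 * Suc k = Suc (Suc (2 * k))" by simp
  then have "fact (2 * Suc k) = of_nat (2 * Suc k) * (of_nat (2 * k
      + 1) * (fact (2 * k) :: complex))"
    by (simp only: fact_Suc of_nat_Suc[symmetric]) simp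
  then show ?thesis
    unfolding odd_fact_def by (simp add: field_simps del: of_nat_Suc) (simp add: algebra_simps)
qed

text \<open>In the sum of i times the i-th correlator every hook occurs twice, with coefficients
  differing by 1, so each survives exactly once. Even and odd arms together give (S + 1)(S^2 -
  1)^(k-1) applied to \<nu> choose 2k, which is (S + 1)^k applied to \<nu> choose k + 1.\<close>

lemma gue_even: "gue \<nu> {#2 * k#} = odd_fact k * hz_seq \<nu> k"
proof (cases k)
  case 0
  then show ?thesis
    using gue_add_0[of \<nu> "{#}"] gue_zeros[of "{#}" \<nu>]
    by (simp add: odd_fact_def hz_seq_eq gbin_def)
next
  case (Suc K)
  let ?h = "\<lambda>a e. hook_term \<nu> (Suc K) a e"
  have "2 * k = Suc (Suc (2 * K))" using Suc by simp
  then have "gue \<nu> {#2 * k#} = (\<Sum>i\<le>Suc (2 * K). of_nat (Suc i) * corr \<nu> 1 (Suc i) (Suc (2 * K)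
      - i))"
    by (simp only: gue_conv_corr)
  also have "\<dots> = (\<Sum>a\<le>K. of_nat (2 * a + 1) * (?h a 0 - ?h a 1) + of_nat (2 * a + 2) * (?h a 1
      - ?h (Suc a) 0))"
    unfolding sum_even_odd
  proof (intro sum.cong refl)
    fix a assume a: "a \<in> {..K}"
    define b where "b = K - a"
    have K: "K = a + b" using a by (simp add: b_def)
    have d: "Suc (2 * K) - 2 * a = 2 * b + 1" "Suc (2 * K) - Suc (2 * a) = 2 * b" using K by auto
    have "corr \<nu> 1 (2 * a + 1) (2 * b + 1) = corr_odd \<nu> a b"
      using corr_closed_form[of "Suc (a + b)" \<nu>] by blast
    moreover have "corr \<nu> 1 (2 * Suc a) (2 * b) = corr_even \<nu> (Suc a) b"
      using corr_closed_form[of "Suc a + b" \<nu>] by blast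
    ultimately show "of_nat (Suc (2 * a)) * corr \<nu> 1 (Suc (2 * a)) (Suc (2 * K) - 2 * a)
        + of_nat (Suc (Suc (2 * a))) * corr \<nu> 1 (Suc (Suc (2 * a))) (Suc (2 * K) - Suc (2 * a))
      = of_nat (2 * a + 1) * (?h a 0 - ?h a 1) + of_nat (2 * a + 2) * (?h a 1 - ?h (Suc a) 0)"
      unfolding d unfolding K corr_odd_conv_hook[symmetric] corr_even_conv_hook[symmetric] by simp
  qed
  also have "\<dots> = (\<Sum>a\<le>K. ?h a 0 + ?h a 1)
      + (\<Sum>a\<le>K. of_nat (2 * a) * ?h a 0 - of_nat (2 * Suc a) * ?h (Suc a) 0)"
    unfolding sum.distrib[symmetric] by (intro sum.cong) (simp_all add: algebra_simps)
  \<comment> \<open>The telescope ends at 0 on the left and, on the right, at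
    \<open>hook_coeff (Suc K) (Suc K)\<close>, whose binomial coefficient vanishes.\<close>
  also have "(\<Sum>a\<le>K. of_nat (2 * a) * ?h a 0 - of_nat (2 * Suc a) * ?h (Suc a) 0) = 0"
    by (subst sum_telescope) (simp add: hook_term_def hook_coeff_def)
  also have "(\<Sum>a\<le>K. ?h a 0 + ?h a 1)
      = odd_fact k * (diff2_sum K (gbin (2 * k)) \<nu> + diff2_sum K (gbin (2 * k)) (\<nu> + 1))"
    unfolding diff2_sum_def distrib_left sum_distrib_left sum.distrib
    by (intro arg_cong2[where f = "(+)"] sum.cong)
      (simp_all add: hook_term_def hook_coeff_def odd_fact_def Suc add_ac del: fact_Suc power_Suc)
  also have "diff2_sum K (gbin (2 * k)) \<nu> + diff2_sum K (gbin (2 * k)) (\<nu> + 1) = hz_seq \<nu> k"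
  proof -
    have "2 * k = (K + 2) + K" using Suc by simp
    then show ?thesis
      by (simp only: diff2_sum_gbin hz_seq_def) (simp add: Suc shift_sum_Suc)
  qed
  finally show ?thesis by simp
qed

theorem theorem5p7:
  shows "(\<forall>i. \<exists>!p. represents p i) \<and>
         hz_poly 0 = [:0, 1:] \<and>
         (\<forall>k::nat. k \<ge> 2 \<longrightarrow>
            smult (of_nat (k + 1)) (hz_poly (2 * k)) =
              smult (of_nat (4 * k - 2)) ([:0, 1:] * hz_poly (2 * k - 2))
              + smult (of_nat ((k - 1) * (2 * k - 1) * (2 * k - 3))) (hz_poly (2 * k - 4)))"
proof (intro conjI allI impI)
  show "\<exists>!p. represents p i" for i
    by (rule represents_ex1)
  have "poly (hz_poly 0) \<nu> = poly [:0, 1:] \<nu>" for \<nu>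
    using gue_even[of \<nu> 0] by (simp add: poly_hz_poly odd_fact_def hz_seq_eq gbin_def)
  then show "hz_poly 0 = [:0, 1:]"
    by (simp only: poly_eq_poly_eq_iff[symmetric] fun_eq_iff) simp
next
  fix k :: nat
  assume "k \<ge> 2"
  then obtain n where k: "k = n + 2" using le_Suc_ex add.commute by metis
  have hz: "poly (hz_poly (2 * m)) \<nu> = odd_fact m * hz_seq \<nu> m" for m \<nu>
    by (simp only: poly_hz_poly gue_even)
  have "k - 1 = n + 1" "2 * k - 1 = 2 * n + 3" "2 * k - 3 = 2 * n + 1"
    by (simp_all add: k)
  then have prod: "(k - 1) * (2 * k - 1) * (2 * k - 3) = (n + 1) * (2 * n + 3) * (2 * n + 1)"
    by (simp only:)
  have idx: "2 * k - 2 = 2 * (n + 1)" "2 * k - 4 = 2 * n" "4 * k - 2 = 2 * (2 * n + 3)" "k + 1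
      = n + 3"
    by (simp_all add: k)
  have fact: "odd_fact (n + 1) = of_nat (2 * n + 1) * odd_fact n"
    "odd_fact (n + 2) = of_nat (2 * n + 3) * (of_nat (2 * n + 1) * odd_fact n)"
    using odd_fact_Suc[of n] odd_fact_Suc[of "Suc n"] by (simp_all add: numeral_3_eq_3)
  have "poly (smult (of_nat (k + 1)) (hz_poly (2 * k))) \<nu>
    = poly (smult (of_nat (4 * k - 2)) ([:0, 1:] * hz_poly (2 * k - 2))
        + smult (of_nat ((k - 1) * (2 * k - 1) * (2 * k - 3))) (hz_poly (2 * k - 4))) \<nu>" for \<nu>
  proof -
    \<comment> \<open>All three terms share the factor (2n + 3)(2n + 1) \<open>odd_fact n\<close>;
      what remains is \<open>hz_seq_recurrence\<close>.\<close>
    have "of_nat (n + 3) * (odd_fact (n + 2) * hz_seq \<nu> (n + 2))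
        = of_nat (2 * n + 3) * of_nat (2 * n + 1) * odd_fact n * (of_nat (n + 3) * hz_seq \<nu> (n
            + 2))"
      unfolding fact by (simp only: mult_ac)
    also have "\<dots> = of_nat (2 * (2 * n + 3)) * (\<nu> * (odd_fact (n + 1) * hz_seq \<nu> (n + 1)))
        + of_nat ((n + 1) * (2 * n + 3) * (2 * n + 1)) * (odd_fact n * hz_seq \<nu> n)"
    proof -
      have "of_nat (2 * (2 * n + 3)) = 2 * (of_nat (2 * n + 3) :: complex)"
        "of_nat ((n + 1) * (2 * n + 3) * (2 * n + 1))
          = of_nat (n + 1) * of_nat (2 * n + 3) * (of_nat (2 * n + 1) :: complex)"
        by (simp_all only: of_nat_mult of_nat_numeral)
      then show ?thesis
        unfolding hz_seq_recurrence fact by (simp only: distrib_left mult_ac)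
    qed
    finally show ?thesis
      unfolding prod idx unfolding k by (simp only: poly_add poly_smult poly_mult hz) simp
  qed
  then show "smult (of_nat (k + 1)) (hz_poly (2 * k)) =
      smult (of_nat (4 * k - 2)) ([:0, 1:] * hz_poly (2 * k - 2))
      + smult (of_nat ((k - 1) * (2 * k - 1) * (2 * k - 3))) (hz_poly (2 * k - 4))"
    by (simp only: poly_eq_poly_eq_iff[symmetric] fun_eq_iff) simp
qed

end
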